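(* Let $U$ be a consistent, sequential, r.e. $\mathcal L$-theory and let $N:S^1_2\lhd U$. Then neither $\mathrm{DEF}_N(\mathcal L)$ nor $\mathrm{TB}_N(\mathcal L)$ semantically defines $\mathrm{USB}_N(\mathcal L)$ modulo $\mathcal L$.
   Context: All theories are first-order. A translation is direct if it is one-dimensional, unrelativized and translates identity to identity. Sequentiality. $\mathrm{AS}$ is the theory in the language $\{\in\}$ with axioms $\exists x\forall y\,(y\notin x)$ and $\forall x\forall y\exists z\forall w\,(w\in z\leftrightarrow (w\in x\vee w=y))$. $U$ is sequential if it interprets $\mathrm{AS}$ via a direct, parameter-free interpretation. $S^1_2$ is Buss's arithmetic. $N:S^1_2\lhd U$ means that $N$ is a one-dimensional, parameter-free relative interpretation of $S^1_2$ in $U$ (identity may be translated as a definable equivalence relation). The language $\mathcal L$ is r.e., and syntax is coded via $N$: for a natural number $n$, $n(x)$ is the $N$-translation of $x=\underline n$ ($\underline n$ the binary numeral of $n$), and for a predicate $R$, $R(\underline n,\dots)$ abbreviates $\exists x(n(x)\wedge R(x,\dots))$. $\ulcorner\phi\urcorner$ is the Gödel number of $\phi$. Semantic theories. $T$ (unary), $D$ (binary), $S$ (binary) are fresh predicates. - $\mathrm{TB}_N(\mathcal L)$ is $U$ plus $T(\underline{\ulcorner\phi\urcorner})\leftrightarrow\phi$ for all $\mathcal L$-sentences $\phi$. - $\mathrm{DEF}_N(\mathcal L)$ is $U$ plus $\forall y\,(D(\underline{\ulcorner\phi(x)\urcorner},y)\leftrightarrow(\exists!x\,\phi(x)\wedge\phi(y)))$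 for all $\mathcal L$-formulae $\phi(x)$. - $\mathrm{USB}_N(\mathcal L)$ is $U$ plus $\forall x\,(S(\underline{\ulcorner\phi\urcorner},x)\leftrightarrow\phi(x))$ for all $\mathcal L$-formulae $\phi(x)$. Definability. A theory $W$ syntactically defines $V$ modulo $\mathcal L$ if $W$ interprets $V$ via a direct, parameter-free translation which translates every $\mathcal L$-formula to itself; when $\mathcal L_V=\mathcal L\cup\{R\}$ this means that there is a formula $\phi_R$ in the language of $W$ such that $W\vdash\Phi[\phi_R/R]$ for every axiom $\Phi$ of $V$. $W$ semantically defines $V$ modulo $\mathcal L$ if for every $\mathcal M\models W$ the elementary diagram $\mathrm{ElDiag}(\mathcal M)$ syntactically defines $V$ modulo $\mathcal L_M$ ($\mathcal L$ with constants for all elements of $\mathcal M$); so formulae with parameters from $\mathcal M$ are allowed and may depend on $\mathcal M$. *)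

theory Defs
  imports Main "HOL-Library.Nat_Bijection"
begin

section \<open>First-order logic with identity\<close>

text \<open>Variables are de Bruijn indices: \<^term>\<open>All \<phi>\<close> binds index 0 of \<open>\<phi>\<close>.\<close>

datatype 'f tm = Var nat | Fun 'f "'f tm list"

datatype ('f, 'r) fm =
    Falsum
  | Eq "'f tm" "'f tm"
  | Rel 'r "'f tm list"
  | Imp "('f, 'r) fm" "('f, 'r) fm"
  | All "('f, 'r) fm"

abbreviation Neg :: "('f, 'r) fm \<Rightarrow> ('f, 'r) fm" where
  "Neg \<phi> \<equiv> Imp \<phi> Falsum"

abbreviation And :: "('f, 'r) fm \<Rightarrow> ('f, 'r) fm \<Rightarrow> ('f, 'r) fm" where
  "And \<phi> \<psi> \<equiv> Neg (Imp \<phi> (Neg \<psi>))"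

abbreviation Or :: "('f, 'r) fm \<Rightarrow> ('f, 'r) fm \<Rightarrow> ('f, 'r) fm" where
  "Or \<phi> \<psi> \<equiv> Imp (Neg \<phi>) \<psi>"

abbreviation Iff :: "('f, 'r) fm \<Rightarrow> ('f, 'r) fm \<Rightarrow> ('f, 'r) fm" where
  "Iff \<phi> \<psi> \<equiv> And (Imp \<phi> \<psi>) (Imp \<psi> \<phi>)"

abbreviation Ex :: "('f, 'r) fm \<Rightarrow> ('f, 'r) fm" where
  "Ex \<phi> \<equiv> Neg (All (Neg \<phi>))"

definition Alls :: "nat \<Rightarrow> ('f, 'r) fm \<Rightarrow> ('f, 'r) fm" where
  "Alls k = (All ^^ k)"

definition Exs :: "nat \<Rightarrow> ('f, 'r) fm \<Rightarrow> ('f, 'r) fm" where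
  "Exs k = ((\<lambda>\<phi>. Ex \<phi>) ^^ k)"

text \<open>\<open>fvb \<phi>\<close> is the least \<open>k\<close> such that all free indices of \<open>\<phi>\<close> are below \<open>k\<close>.\<close>

primrec fvb_tm :: "'f tm \<Rightarrow> nat" where
  "fvb_tm (Var i) = Suc i"
| "fvb_tm (Fun f ts) = foldr max (map fvb_tm ts) 0"

primrec fvb :: "('f, 'r) fm \<Rightarrow> nat" where
  "fvb Falsum = 0"
| "fvb (Eq s t) = max (fvb_tm s) (fvb_tm t)"
| "fvb (Rel r ts) = foldr max (map fvb_tm ts) 0"
| "fvb (Imp \<phi> \<psi>) = max (fvb \<phi>) (fvb \<psi>)"
| "fvb (All \<phi>) = fvb \<phi> - 1"

definition closure :: "('f, 'r) fm \<Rightarrow> ('f, 'r) fm" where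
  "closure \<phi> = Alls (fvb \<phi>) \<phi>"

primrec subst_tm :: "(nat \<Rightarrow> 'f tm) \<Rightarrow> 'f tm \<Rightarrow> 'f tm" where
  "subst_tm \<sigma> (Var i) = \<sigma> i"
| "subst_tm \<sigma> (Fun f ts) = Fun f (map (subst_tm \<sigma>) ts)"

definition shift_tm :: "'f tm \<Rightarrow> 'f tm" where
  "shift_tm = subst_tm (\<lambda>i. Var (Suc i))"

definition under :: "(nat \<Rightarrow> 'f tm) \<Rightarrow> nat \<Rightarrow> 'f tm" where
  "under \<sigma> i = (case i of 0 \<Rightarrow> Var 0 | Suc j \<Rightarrow> shift_tm (\<sigma> j))"

primrec subst :: "(nat \<Rightarrow> 'f tm) \<Rightarrow> ('f, 'r) fm \<Rightarrow> ('f, 'r) fm" where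
  "subst \<sigma> Falsum = Falsum"
| "subst \<sigma> (Eq s t) = Eq (subst_tm \<sigma> s) (subst_tm \<sigma> t)"
| "subst \<sigma> (Rel r ts) = Rel r (map (subst_tm \<sigma>) ts)"
| "subst \<sigma> (Imp \<phi> \<psi>) = Imp (subst \<sigma> \<phi>) (subst \<sigma> \<psi>)"
| "subst \<sigma> (All \<phi>) = All (subst (under \<sigma>) \<phi>)"

definition shift :: "('f, 'r) fm \<Rightarrow> ('f, 'r) fm" where
  "shift = subst (\<lambda>i. Var (Suc i))"

definition inst :: "'f tm \<Rightarrow> ('f, 'r) fm \<Rightarrow> ('f, 'r) fm" where
  "inst t = subst (\<lambda>i. case i of 0 \<Rightarrow> t | Suc j \<Rightarrow> Var j)"

definition ExU :: "('f, 'r) fm \<Rightarrow> ('f, 'r) fm" where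
  "ExU \<phi> = Ex (And \<phi> (All (Imp
     (subst (\<lambda>i. case i of 0 \<Rightarrow> Var 0 | Suc j \<Rightarrow> Var (Suc (Suc j))) \<phi>)
     (Eq (Var 0) (Var 1)))))"

text \<open>Natural deduction for classical logic; \<open>\<Gamma>\<close> may be infinite. In \<open>AllI\<close> index 0 is fresh
  for the shifted context.\<close>

inductive proves :: "('f, 'r) fm set \<Rightarrow> ('f, 'r) fm \<Rightarrow> bool" (infix "\<turnstile>" 50) where
  Assm: "\<phi> \<in> \<Gamma> \<Longrightarrow> \<Gamma> \<turnstile> \<phi>"
| ImpI: "insert \<phi> \<Gamma> \<turnstile> \<psi> \<Longrightarrow> \<Gamma> \<turnstile> Imp \<phi> \<psi>"
| ImpE: "\<Gamma> \<turnstile> Imp \<phi> \<psi> \<Longrightarrow> \<Gamma> \<turnstile> \<phi> \<Longrightarrow> \<Gamma> \<turnstile> \<psi>"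
| Contr: "insert (Neg \<phi>) \<Gamma> \<turnstile> Falsum \<Longrightarrow> \<Gamma> \<turnstile> \<phi>"
| AllI: "shift ` \<Gamma> \<turnstile> \<phi> \<Longrightarrow> \<Gamma> \<turnstile> All \<phi>"
| AllE: "\<Gamma> \<turnstile> All \<phi> \<Longrightarrow> \<Gamma> \<turnstile> inst t \<phi>"
| EqRefl: "\<Gamma> \<turnstile> Eq t t"
| EqSubst: "\<Gamma> \<turnstile> Eq s t \<Longrightarrow> \<Gamma> \<turnstile> inst s \<phi> \<Longrightarrow> \<Gamma> \<turnstile> inst t \<phi>"

definition consistent :: "('f, 'r) fm set \<Rightarrow> bool" where
  "consistent W \<longleftrightarrow> \<not> W \<turnstile> Falsum"


section \<open>Languages and theories\<close>

text \<open>A language is given by its function and relation symbols, each paired with its arity.\<close>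

record ('f, 'r) lang =
  funs :: "('f \<times> nat) set"
  rels :: "('r \<times> nat) set"

fun in_lang_tm :: "('f, 'r) lang \<Rightarrow> 'f tm \<Rightarrow> bool" where
  "in_lang_tm L (Var i) \<longleftrightarrow> True"
| "in_lang_tm L (Fun f ts) \<longleftrightarrow> (f, length ts) \<in> funs L \<and> (\<forall>t \<in> set ts. in_lang_tm L t)"

primrec in_lang :: "('f, 'r) lang \<Rightarrow> ('f, 'r) fm \<Rightarrow> bool" where
  "in_lang L Falsum \<longleftrightarrow> True"
| "in_lang L (Eq s t) \<longleftrightarrow> in_lang_tm L s \<and> in_lang_tm L t"
| "in_lang L (Rel r ts) \<longleftrightarrow> (r, length ts) \<in> rels L \<and> (\<forall>t \<in> set ts. in_lang_tm L t)"
| "in_lang L (Imp \<phi> \<psi>) \<longleftrightarrow> in_lang L \<phi> \<and> in_lang L \<psi>"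
| "in_lang L (All \<phi>) \<longleftrightarrow> in_lang L \<phi>"

definition sentence :: "('f, 'r) lang \<Rightarrow> ('f, 'r) fm \<Rightarrow> bool" where
  "sentence L \<phi> \<longleftrightarrow> in_lang L \<phi> \<and> fvb \<phi> = 0"

definition is_theory :: "('f, 'r) lang \<Rightarrow> ('f, 'r) fm set \<Rightarrow> bool" where
  "is_theory L W \<longleftrightarrow> (\<forall>\<phi> \<in> W. sentence L \<phi>)"


section \<open>Recursively enumerable sets\<close>

text \<open>Partial recursive functions, with a big-step evaluation relation. \<open>RMin f\<close> is unbounded
  search in the first argument; all earlier values must be defined and nonzero.\<close>

datatype recf =
    RZero
  | RSuc
  | RProj nat
  | RComp recf "recf list"
  | RPrim recf recf
  | RMin recf

inductive rec_eval :: "recf \<Rightarrow> nat list \<Rightarrow> nat \<Rightarrow> bool" where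
  "rec_eval RZero xs 0"
| "rec_eval RSuc (x # xs) (Suc x)"
| "i < length xs \<Longrightarrow> rec_eval (RProj i) xs (xs ! i)"
| "list_all2 (\<lambda>g y. rec_eval g xs y) gs ys \<Longrightarrow> rec_eval f ys z \<Longrightarrow> rec_eval (RComp f gs) xs z"
| "rec_eval f xs y \<Longrightarrow> rec_eval (RPrim f g) (0 # xs) y"
| "rec_eval (RPrim f g) (n # xs) y \<Longrightarrow> rec_eval g (n # y # xs) z \<Longrightarrow>
     rec_eval (RPrim f g) (Suc n # xs) z"
| "rec_eval f (n # xs) 0 \<Longrightarrow> \<forall>i < n. \<exists>y. rec_eval f (i # xs) (Suc y) \<Longrightarrow>
     rec_eval (RMin f) xs n"

definition re_set :: "nat set \<Rightarrow> bool" where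
  "re_set A \<longleftrightarrow> (\<exists>f. A = {x. \<exists>y. rec_eval f [x] y})"

definition re_lang :: "(nat, nat) lang \<Rightarrow> bool" where
  "re_lang L \<longleftrightarrow> re_set (prod_encode ` funs L) \<and> re_set (prod_encode ` rels L)"


section \<open>Goedel numbers\<close>

text \<open>Formulas are written as self-delimiting bit strings in prefix notation, and the string, with
  a leading 1, is read in base 2. Hence the length of the binary expansion of a Goedel number is
  linear in the length of the formula, as is customary for weak arithmetics.\<close>

fun nat_bits :: "nat \<Rightarrow> bool list" where
  "nat_bits n = (if n = 0 then [False] else True # odd n # nat_bits (n div 2))"

declare nat_bits.simps [simp del]

primrec tm_bits :: "nat tm \<Rightarrow> bool list" where
  "tm_bits (Var i) = False # nat_bits i"
| "tm_bits (Fun f ts) = True # nat_bits f @ nat_bits (length ts) @ concat (map tm_bits ts)"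

primrec fm_bits :: "(nat, nat) fm \<Rightarrow> bool list" where
  "fm_bits Falsum = [False, False, False]"
| "fm_bits (Eq s t) = [False, False, True] @ tm_bits s @ tm_bits t"
| "fm_bits (Rel r ts) =
     [False, True, False] @ nat_bits r @ nat_bits (length ts) @ concat (map tm_bits ts)"
| "fm_bits (Imp \<phi> \<psi>) = [False, True, True] @ fm_bits \<phi> @ fm_bits \<psi>"
| "fm_bits (All \<phi>) = [True, False, False] @ fm_bits \<phi>"

definition gn :: "(nat, nat) fm \<Rightarrow> nat" where
  "gn \<phi> = foldl (\<lambda>n b. 2 * n + of_bool b) 1 (fm_bits \<phi>)"


section \<open>Direct translations and sequentiality\<close>

text \<open>A direct, parameter-free translation, for languages in which only relation symbols need to be
  translated; \<open>G r k\<close> is the formula, in the indices below \<open>k\<close>, for the \<open>k\<close>-ary symbol \<open>r\<close>.\<close>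

primrec direct_tr :: "('r \<Rightarrow> nat \<Rightarrow> ('f, 'q) fm) \<Rightarrow> ('f, 'r) fm \<Rightarrow> ('f, 'q) fm" where
  "direct_tr G Falsum = Falsum"
| "direct_tr G (Eq s t) = Eq s t"
| "direct_tr G (Rel r ts) = subst (\<lambda>i. ts ! i) (G r (length ts))"
| "direct_tr G (Imp \<phi> \<psi>) = Imp (direct_tr G \<phi>) (direct_tr G \<psi>)"
| "direct_tr G (All \<phi>) = All (direct_tr G \<phi>)"

definition direct_interpretation ::
  "('r \<Rightarrow> nat \<Rightarrow> ('f, 'q) fm) \<Rightarrow> ('f, 'r) lang \<Rightarrow> ('f, 'r) fm set
     \<Rightarrow> ('f, 'q) lang \<Rightarrow> ('f, 'q) fm set \<Rightarrow> bool" where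
  "direct_interpretation G LV V LW W \<longleftrightarrow>
     funs LV \<subseteq> funs LW \<and>
     (\<forall>(r, k) \<in> rels LV. in_lang LW (G r k) \<and> fvb (G r k) \<le> k) \<and>
     (\<forall>\<Phi> \<in> V. W \<turnstile> direct_tr G \<Phi>)"

datatype as_rel = Mem

definition AS_lang :: "('f, as_rel) lang" where
  "AS_lang = \<lparr>funs = {}, rels = {(Mem, 2)}\<rparr>"

definition AS :: "('f, as_rel) fm set" where
  "AS = {Ex (All (Neg (Rel Mem [Var 0, Var 1]))),
         All (All (Ex (All (Iff (Rel Mem [Var 0, Var 1])
                                (Or (Rel Mem [Var 0, Var 3]) (Eq (Var 0) (Var 2)))))))}"

definition sequential :: "('f, 'r) lang \<Rightarrow> ('f, 'r) fm set \<Rightarrow> bool" where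
  "sequential L U \<longleftrightarrow> (\<exists>G. direct_interpretation G AS_lang AS L U)"


section \<open>Relative interpretations\<close>

text \<open>One-dimensional and parameter-free. \<open>idom\<close> has free index 0, \<open>ieq\<close> indices 0 and 1,
  \<open>irel p k\<close> the indices below \<open>k\<close>, and \<open>ifn g k\<close> the indices below \<open>k\<close> for the arguments and
  index \<open>k\<close> for the value.\<close>

record ('g, 'p, 'f, 'r) interp =
  idom :: "('f, 'r) fm"
  ieq :: "('f, 'r) fm"
  ifn :: "'g \<Rightarrow> nat \<Rightarrow> ('f, 'r) fm"
  irel :: "'p \<Rightarrow> nat \<Rightarrow> ('f, 'r) fm"

definition interp_ok ::
  "('g, 'p, 'f, 'r) interp \<Rightarrow> ('g, 'p) lang \<Rightarrow> ('f, 'r) lang \<Rightarrow> bool" where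
  "interp_ok N LV LU \<longleftrightarrow>
     in_lang LU (idom N) \<and> fvb (idom N) \<le> 1 \<and>
     in_lang LU (ieq N) \<and> fvb (ieq N) \<le> 2 \<and>
     (\<forall>(g, k) \<in> funs LV. in_lang LU (ifn N g k) \<and> fvb (ifn N g k) \<le> Suc k) \<and>
     (\<forall>(p, k) \<in> rels LV. in_lang LU (irel N p k) \<and> fvb (irel N p k) \<le> k)"

text \<open>Nested terms are eliminated as usual: \<open>P(t\<^sub>0,\<dots>)\<close> becomes
  \<open>\<exists>z\<^sub>0 \<dots> (z\<^sub>0 = t\<^sub>0 \<and> \<dots> \<and> P(z\<^sub>0,\<dots>))\<close>. The formula \<open>tr_tm N t\<close> says that index 0 lies in
  the domain and is a value of \<open>t\<close>, whose index \<open>j\<close> has become \<open>Suc j\<close>. Consequently translated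
  atomic formulas only hold of elements of the domain.

  \<open>place m [\<psi>\<^sub>0, \<psi>\<^sub>1, \<dots>]\<close> moves index 0 of \<open>\<psi>\<^sub>i\<close> to \<open>i\<close> and index \<open>Suc j\<close> to \<open>j + m\<close>.\<close>

definition place :: "nat \<Rightarrow> ('f, 'r) fm list \<Rightarrow> ('f, 'r) fm list" where
  "place m \<psi>s =
     map (\<lambda>(i, \<psi>). subst (\<lambda>n. case n of 0 \<Rightarrow> Var i | Suc j \<Rightarrow> Var (j + m)) \<psi>) (enumerate 0 \<psi>s)"

primrec tr_tm :: "('g, 'p, 'f, 'r) interp \<Rightarrow> 'g tm \<Rightarrow> ('f, 'r) fm" where
  "tr_tm N (Var i) = And (idom N) (Eq (Var 0) (Var (Suc i)))"
| "tr_tm N (Fun g ts) = And (idom N)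
     (Exs (length ts)
       (foldr And (place (Suc (length ts)) (map (tr_tm N) ts)) (ifn N g (length ts))))"

primrec tr :: "('g, 'p, 'f, 'r) interp \<Rightarrow> ('g, 'p) fm \<Rightarrow> ('f, 'r) fm" where
  "tr N Falsum = Falsum"
| "tr N (Eq s t) = Exs 2 (foldr And (place 2 [tr_tm N s, tr_tm N t]) (ieq N))"
| "tr N (Rel p ts) = Exs (length ts)
     (foldr And (place (length ts) (map (tr_tm N) ts)) (irel N p (length ts)))"
| "tr N (Imp \<phi> \<psi>) = Imp (tr N \<phi>) (tr N \<psi>)"
| "tr N (All \<phi>) = All (Imp (idom N) (tr N \<phi>))"

text \<open>Quantifying over the theorems of \<open>V\<close>, not just its axioms, includes what logic presupposes:
  the domain is nonempty, \<open>ieq\<close> is a congruence on it, and the function symbols are translated to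
  functions modulo \<open>ieq\<close>.\<close>

definition relative_interpretation ::
  "('g, 'p, 'f, 'r) interp \<Rightarrow> ('g, 'p) lang \<Rightarrow> ('g, 'p) fm set
     \<Rightarrow> ('f, 'r) lang \<Rightarrow> ('f, 'r) fm set \<Rightarrow> bool" where
  "relative_interpretation N LV V LU U \<longleftrightarrow>
     interp_ok N LV LU \<and> (\<forall>\<phi>. sentence LV \<phi> \<and> V \<turnstile> \<phi> \<longrightarrow> U \<turnstile> tr N \<phi>)"


section \<open>Buss's arithmetic\<close>

datatype ar_fun = Zero | Succ | Plus | Times | Len | Half | Smash
datatype ar_rel = Leq

definition S12_lang :: "(ar_fun, ar_rel) lang" where
  "S12_lang = \<lparr>funs = {(Zero, 0), (Succ, 1), (Plus, 2), (Times, 2), (Len, 1), (Half, 1), (Smash, 2)},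
               rels = {(Leq, 2)}\<rparr>"

abbreviation "tZ \<equiv> Fun Zero []"
abbreviation "tS t \<equiv> Fun Succ [t]"
abbreviation tAdd (infixl "\<oplus>" 65) where "s \<oplus> t \<equiv> Fun Plus [s, t]"
abbreviation tMul (infixl "\<odot>" 70) where "s \<odot> t \<equiv> Fun Times [s, t]"
abbreviation tSmash (infixl "\<sharp>" 75) where "s \<sharp> t \<equiv> Fun Smash [s, t]"
abbreviation "tLen t \<equiv> Fun Len [t]"
abbreviation "tHalf t \<equiv> Fun Half [t]"
abbreviation "tOne \<equiv> tS tZ"
abbreviation "tTwo \<equiv> tS (tS tZ)"
abbreviation fEq (infix "\<doteq>" 60) where "s \<doteq> t \<equiv> Eq s t"
abbreviation fLe (infix "\<preceq>" 60) where "s \<preceq> t \<equiv> Rel Leq [s, t]"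

text \<open>The 32 open axioms, in Buss's order, for arbitrary terms in place of the variables; they are
  used with distinct variables and universally closed.\<close>

definition basic_axioms ::
  "ar_fun tm \<Rightarrow> ar_fun tm \<Rightarrow> ar_fun tm \<Rightarrow> ar_fun tm \<Rightarrow> (ar_fun, ar_rel) fm list" where
  "basic_axioms x y z u =
    [Imp (y \<preceq> x) (y \<preceq> tS x),
     Neg (x \<doteq> tS x),
     tZ \<preceq> x,
     Iff (And (x \<preceq> y) (Neg (x \<doteq> y))) (tS x \<preceq> y),
     Imp (Neg (x \<doteq> tZ)) (Neg (tTwo \<odot> x \<doteq> tZ)),
     Or (y \<preceq> x) (x \<preceq> y),
     Imp (And (x \<preceq> y) (y \<preceq> x)) (x \<doteq> y),
     Imp (And (x \<preceq> y) (y \<preceq> z)) (x \<preceq> z),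
     tLen tZ \<doteq> tZ,
     Imp (Neg (x \<doteq> tZ))
       (And (tLen (tTwo \<odot> x) \<doteq> tS (tLen x)) (tLen (tS (tTwo \<odot> x)) \<doteq> tS (tLen x))),
     tLen tOne \<doteq> tOne,
     Imp (x \<preceq> y) (tLen x \<preceq> tLen y),
     tLen (x \<sharp> y) \<doteq> tS (tLen x \<odot> tLen y),
     tZ \<sharp> y \<doteq> tOne,
     Imp (Neg (x \<doteq> tZ))
       (And (tOne \<sharp> (tTwo \<odot> x) \<doteq> tTwo \<odot> (tOne \<sharp> x))
            (tOne \<sharp> tS (tTwo \<odot> x) \<doteq> tTwo \<odot> (tOne \<sharp> x))),
     x \<sharp> y \<doteq> y \<sharp> x,
     Imp (tLen x \<doteq> tLen y) (x \<sharp> z \<doteq> y \<sharp> z),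
     Imp (tLen x \<doteq> tLen u \<oplus> tLen z) (x \<sharp> y \<doteq> (u \<sharp> y) \<odot> (z \<sharp> y)),
     x \<preceq> x \<oplus> y,
     Imp (And (x \<preceq> y) (Neg (x \<doteq> y)))
       (And (tS (tTwo \<odot> x) \<preceq> tTwo \<odot> y) (Neg (tS (tTwo \<odot> x) \<doteq> tTwo \<odot> y))),
     x \<oplus> y \<doteq> y \<oplus> x,
     x \<oplus> tZ \<doteq> x,
     x \<oplus> tS y \<doteq> tS (x \<oplus> y),
     (x \<oplus> y) \<oplus> z \<doteq> x \<oplus> (y \<oplus> z),
     Iff (x \<oplus> y \<preceq> x \<oplus> z) (y \<preceq> z),
     x \<odot> tZ \<doteq> tZ,
     x \<odot> tS y \<doteq> x \<odot> y \<oplus> x,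
     x \<odot> y \<doteq> y \<odot> x,
     x \<odot> (y \<oplus> z) \<doteq> x \<odot> y \<oplus> x \<odot> z,
     Imp (tOne \<preceq> x) (Iff (x \<odot> y \<preceq> x \<odot> z) (y \<preceq> z)),
     Imp (Neg (x \<doteq> tZ)) (tLen x \<doteq> tS (tLen (tHalf x))),
     Iff (x \<doteq> tHalf y) (Or (tTwo \<odot> x \<doteq> y) (tS (tTwo \<odot> x) \<doteq> y))]"

definition BASIC :: "(ar_fun, ar_rel) fm set" where
  "BASIC = closure ` set (basic_axioms (Var 0) (Var 1) (Var 2) (Var 3))"

text \<open>Bounded quantifiers; the bound \<open>t\<close> lives outside the scope of the quantifier.\<close>

definition AllB :: "ar_fun tm \<Rightarrow> (ar_fun, ar_rel) fm \<Rightarrow> (ar_fun, ar_rel) fm" where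
  "AllB t A = All (Imp (Var 0 \<preceq> shift_tm t) A)"

definition ExB :: "ar_fun tm \<Rightarrow> (ar_fun, ar_rel) fm \<Rightarrow> (ar_fun, ar_rel) fm" where
  "ExB t A = Ex (And (Var 0 \<preceq> shift_tm t) A)"

inductive sharply_bounded :: "(ar_fun, ar_rel) fm \<Rightarrow> bool" where
  "sharply_bounded Falsum"
| "sharply_bounded (Eq s t)"
| "sharply_bounded (Rel p ts)"
| "sharply_bounded A \<Longrightarrow> sharply_bounded B \<Longrightarrow> sharply_bounded (Imp A B)"
| "sharply_bounded A \<Longrightarrow> sharply_bounded (AllB (tLen t) A)"
| "sharply_bounded A \<Longrightarrow> sharply_bounded (ExB (tLen t) A)"

inductive sigma_b1 :: "(ar_fun, ar_rel) fm \<Rightarrow> bool"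
  and pi_b1 :: "(ar_fun, ar_rel) fm \<Rightarrow> bool" where
  "sharply_bounded A \<Longrightarrow> sigma_b1 A"
| "sigma_b1 A \<Longrightarrow> sigma_b1 (ExB t A)"
| "sigma_b1 A \<Longrightarrow> sigma_b1 (AllB (tLen t) A)"
| "sigma_b1 A \<Longrightarrow> sigma_b1 B \<Longrightarrow> sigma_b1 (And A B)"
| "sigma_b1 A \<Longrightarrow> sigma_b1 B \<Longrightarrow> sigma_b1 (Or A B)"
| "pi_b1 B \<Longrightarrow> sigma_b1 (Neg B)"
| "pi_b1 B \<Longrightarrow> sigma_b1 A \<Longrightarrow> sigma_b1 (Imp B A)"
| "sharply_bounded A \<Longrightarrow> pi_b1 A"
| "pi_b1 A \<Longrightarrow> pi_b1 (AllB t A)"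
| "pi_b1 A \<Longrightarrow> pi_b1 (ExB (tLen t) A)"
| "pi_b1 A \<Longrightarrow> pi_b1 B \<Longrightarrow> pi_b1 (And A B)"
| "pi_b1 A \<Longrightarrow> pi_b1 B \<Longrightarrow> pi_b1 (Or A B)"
| "sigma_b1 B \<Longrightarrow> pi_b1 (Neg B)"
| "sigma_b1 B \<Longrightarrow> pi_b1 A \<Longrightarrow> pi_b1 (Imp B A)"

text \<open>Polynomial induction on index 0; the other free indices are parameters.\<close>

definition PIND :: "(ar_fun, ar_rel) fm \<Rightarrow> (ar_fun, ar_rel) fm" where
  "PIND A = Imp (And (inst tZ A)
      (All (Imp (subst (\<lambda>i. case i of 0 \<Rightarrow> tHalf (Var 0) | Suc j \<Rightarrow> Var (Suc j)) A) A)))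
    (All A)"

definition S12 :: "(ar_fun, ar_rel) fm set" where
  "S12 = BASIC \<union> {closure (PIND A) | A. in_lang S12_lang A \<and> sigma_b1 A}"

fun bnum :: "nat \<Rightarrow> ar_fun tm" where
  "bnum n = (if n = 0 then tZ
             else if even n then tTwo \<odot> bnum (n div 2)
             else tS (tTwo \<odot> bnum (n div 2)))"

declare bnum.simps [simp del]

text \<open>The formula \<open>n(x)\<close>, with \<open>x\<close> as index 0.\<close>

definition num_fm :: "(ar_fun, ar_rel, 'f, 'r) interp \<Rightarrow> nat \<Rightarrow> ('f, 'r) fm" where
  "num_fm N n = tr N (Eq (Var 0) (bnum n))"


section \<open>Semantic theories\<close>

text \<open>The symbols of the base language, and the three fresh predicates.\<close>

datatype 'r xrel = Base 'r | TrueP | DefP | SatP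

abbreviation emb :: "('f, 'r) fm \<Rightarrow> ('f, 'r xrel) fm" where
  "emb \<equiv> map_fm id Base"

definition base_lang :: "('f, 'r) lang \<Rightarrow> ('f, 'r xrel) lang" where
  "base_lang L = \<lparr>funs = funs L, rels = map_prod Base id ` rels L\<rparr>"

definition add_rel :: "'r \<Rightarrow> nat \<Rightarrow> ('f, 'r) lang \<Rightarrow> ('f, 'r) lang" where
  "add_rel R k L = \<lparr>funs = funs L, rels = insert (R, k) (rels L)\<rparr>"

type_synonym arith_interp = "(ar_fun, ar_rel, nat, nat) interp"

definition TB_lang :: "(nat, nat) lang \<Rightarrow> (nat, nat xrel) lang" where
  "TB_lang L = add_rel TrueP 1 (base_lang L)"

definition DEF_lang :: "(nat, nat) lang \<Rightarrow> (nat, nat xrel) lang" where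
  "DEF_lang L = add_rel DefP 2 (base_lang L)"

definition USB_lang :: "(nat, nat) lang \<Rightarrow> (nat, nat xrel) lang" where
  "USB_lang L = add_rel SatP 2 (base_lang L)"

text \<open>In the axioms below, \<open>Ex (And (emb (num_fm N n)) (Rel R [Var 0, \<dots>]))\<close> is \<open>R(n, \<dots>)\<close>, and an
  \<open>L\<close>-formula \<open>\<phi>(x)\<close> is an \<open>L\<close>-formula whose only free index, if any, is 0.\<close>

definition TB ::
  "(nat, nat) lang \<Rightarrow> (nat, nat) fm set \<Rightarrow> arith_interp \<Rightarrow> (nat, nat xrel) fm set" where
  "TB L U N = emb ` U \<union>
     {Iff (Ex (And (emb (num_fm N (gn \<phi>))) (Rel TrueP [Var 0]))) (emb \<phi>) | \<phi>. sentence L \<phi>}"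

definition DEF ::
  "(nat, nat) lang \<Rightarrow> (nat, nat) fm set \<Rightarrow> arith_interp \<Rightarrow> (nat, nat xrel) fm set" where
  "DEF L U N = emb ` U \<union>
     {All (Iff (Ex (And (emb (num_fm N (gn \<phi>))) (Rel DefP [Var 0, Var 1])))
               (And (ExU (emb \<phi>)) (emb \<phi>))) | \<phi>. in_lang L \<phi> \<and> fvb \<phi> \<le> 1}"

definition USB ::
  "(nat, nat) lang \<Rightarrow> (nat, nat) fm set \<Rightarrow> arith_interp \<Rightarrow> (nat, nat xrel) fm set" where
  "USB L U N = emb ` U \<union>
     {All (Iff (Ex (And (emb (num_fm N (gn \<phi>))) (Rel SatP [Var 0, Var 1])))
               (emb \<phi>)) | \<phi>. in_lang L \<phi> \<and> fvb \<phi> \<le> 1}"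


section \<open>Structures and definability\<close>

record ('m, 'f, 'r) struct =
  mdom :: "'m set"
  mfn :: "'f \<Rightarrow> 'm list \<Rightarrow> 'm"
  mrel :: "'r \<Rightarrow> 'm list \<Rightarrow> bool"

definition is_struct :: "('f, 'r) lang \<Rightarrow> ('m, 'f, 'r) struct \<Rightarrow> bool" where
  "is_struct L M \<longleftrightarrow> mdom M \<noteq> {} \<and>
     (\<forall>(f, k) \<in> funs L. \<forall>xs. length xs = k \<and> set xs \<subseteq> mdom M \<longrightarrow> mfn M f xs \<in> mdom M)"

primrec eval_tm :: "('m, 'f, 'r) struct \<Rightarrow> (nat \<Rightarrow> 'm) \<Rightarrow> 'f tm \<Rightarrow> 'm" where
  "eval_tm M e (Var i) = e i"
| "eval_tm M e (Fun f ts) = mfn M f (map (eval_tm M e) ts)"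

primrec holds :: "('m, 'f, 'r) struct \<Rightarrow> (nat \<Rightarrow> 'm) \<Rightarrow> ('f, 'r) fm \<Rightarrow> bool" where
  "holds M e Falsum \<longleftrightarrow> False"
| "holds M e (Eq s t) \<longleftrightarrow> eval_tm M e s = eval_tm M e t"
| "holds M e (Rel r ts) \<longleftrightarrow> mrel M r (map (eval_tm M e) ts)"
| "holds M e (Imp \<phi> \<psi>) \<longleftrightarrow> (holds M e \<phi> \<longrightarrow> holds M e \<psi>)"
| "holds M e (All \<phi>) \<longleftrightarrow> (\<forall>a \<in> mdom M. holds M (case_nat a e) \<phi>)"

definition true_in :: "('m, 'f, 'r) struct \<Rightarrow> ('f, 'r) fm \<Rightarrow> bool" where
  "true_in M \<phi> \<longleftrightarrow> (\<forall>e. range e \<subseteq> mdom M \<longrightarrow> holds M e \<phi>)"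

definition is_model ::
  "('f, 'r) lang \<Rightarrow> ('m, 'f, 'r) struct \<Rightarrow> ('f, 'r) fm set \<Rightarrow> bool" where
  "is_model L M W \<longleftrightarrow> is_struct L M \<and> (\<forall>\<phi> \<in> W. true_in M \<phi>)"

text \<open>The language with a constant \<open>Inr a\<close> for every element \<open>a\<close> of \<open>A\<close>.\<close>

definition with_consts :: "'m set \<Rightarrow> ('f, 'r) lang \<Rightarrow> ('f + 'm, 'r) lang" where
  "with_consts A L =
     \<lparr>funs = map_prod Inl id ` funs L \<union> (\<lambda>a. (Inr a, 0)) ` A, rels = rels L\<rparr>"

definition expand :: "('m, 'f, 'r) struct \<Rightarrow> ('m, 'f + 'm, 'r) struct" where
  "expand M = \<lparr>mdom = mdom M, mfn = case_sum (mfn M) (\<lambda>a _. a), mrel = mrel M\<rparr>"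

definition ElDiag ::
  "('f, 'r) lang \<Rightarrow> ('m, 'f, 'r) struct \<Rightarrow> ('f + 'm, 'r) fm set" where
  "ElDiag L M = {\<phi>. sentence (with_consts (mdom M) L) \<phi> \<and> true_in (expand M) \<phi>}"

text \<open>Definability of the \<open>LV\<close>-theory \<open>V\<close> in the \<open>LW\<close>-theory \<open>W\<close>, where \<open>LV\<close> expands \<open>L\<close> by
  relation symbols only.\<close>

definition syntactically_defines ::
  "('f, 'r) lang \<Rightarrow> ('f, 'r) lang \<Rightarrow> ('f, 'r) fm set
     \<Rightarrow> ('f, 'r) lang \<Rightarrow> ('f, 'r) fm set \<Rightarrow> bool" where
  "syntactically_defines L LW W LV V \<longleftrightarrow>
     (\<exists>G. direct_interpretation G LV V LW W \<and>
          (\<forall>(r, k) \<in> rels L. G r k = Rel r (map Var [0..<k])))"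

text \<open>The type argument is the type from which the domains of the structures are drawn, as HOL
  cannot quantify over all types. If semantic definability fails for some type, then it fails for
  the class of all structures.\<close>

definition semantically_defines ::
  "'m itself \<Rightarrow> ('f, 'r) lang \<Rightarrow> ('f, 'r) lang \<Rightarrow> ('f, 'r) fm set
     \<Rightarrow> ('f, 'r) lang \<Rightarrow> ('f, 'r) fm set \<Rightarrow> bool" where
  "semantically_defines _ L LW W LV V \<longleftrightarrow>
     (\<forall>M :: ('m, 'f, 'r) struct. is_model LW M W \<longrightarrow>
        syntactically_defines (with_consts (mdom M) L)
          (with_consts (mdom M) LW) (ElDiag LW M)
          (with_consts (mdom M) LV) (map_fm Inl id ` V))"

end

theory Submission
  imports Defs "HOL-Library.Countable"
begin

text \<open>A sequential theory can code finite sets and finite binary relations, since adjunction is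
  available. Any finite set of the axioms for \<open>T\<close> or \<open>D\<close> only restricts the predicate at finitely
  many numerals, where \<open>T\<close> has to hold of finitely many codes, and \<open>D\<close> of finitely many pairs because
  \<open>\<exists>!x \<phi>(x)\<close> leaves a single value. So by compactness some model of \<open>U\<close> has an element \<open>c\<close> coding a
  \<open>T\<close> (or \<open>D\<close>) that satisfies all the axioms. In that model \<open>T\<close> (or \<open>D\<close>) is \<open>L\<close>-definable with the
  parameter \<open>c\<close>, so a definition of \<open>S\<close> would yield an \<open>L\<close>-definition of \<open>S\<close> with parameters. Coded
  pairs merge the parameters into one element \<open>b\<close>, and Tarski's argument, applied to a pair of the liar
  formula's own code and \<open>b\<close>, gives a contradiction.\<close>

section \<open>Syntax and semantics\<close>

text \<open>Three obstacles shape the development. Provability is given by a calculus, while the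
  argument lives in models. Soundness and completeness connect the two: completeness yields models
  whose elements are natural numbers, matching the type at which semantic definability is refuted,
  and it also lets provability in \<open>S12\<close> be checked semantically. The element
  \<open>c\<close> enters as free index 0 of the axioms. Next, \<open>N\<close> may translate
  identity by an equivalence, so one number can have many representatives. Three facts replace
  uniqueness: each numeral has a representative, different numerals share none, and the
  representatives of a numeral are exactly the elements equal, in the sense of \<open>N\<close>, to
  any one of them. With injectivity of \<open>gn\<close>, finitely many axioms then never clash on a
  code. Finally, \<open>USB\<close> speaks only of formulas with one free variable, while a
  definition of \<open>S\<close> may use any finite number of parameters. Pairing packs into one
  argument all that the liar formula has to know. Its own code reaches it as data, so the
  diagonalisation happens in the choice of the argument.\<close>

lemma foldr_max_le_iff: "foldr max (map g ts) 0 \<le> (k::nat) \<longleftrightarrow> (\<forall>t \<in> set ts. g t \<le> k)"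
  by (induction ts) auto

lemma fvb_tm_Fun_le [simp]: "fvb_tm (Fun f ts) \<le> k \<longleftrightarrow> (\<forall>t \<in> set ts. fvb_tm t \<le> k)"
  by (simp add: foldr_max_le_iff)

lemma fvb_Rel_le [simp]: "fvb (Rel r ts) \<le> k \<longleftrightarrow> (\<forall>t \<in> set ts. fvb_tm t \<le> k)"
  by (simp add: foldr_max_le_iff)

lemma fvb_All_le [simp]: "fvb (All \<phi>) \<le> k \<longleftrightarrow> fvb \<phi> \<le> Suc k"
  by auto

declare fvb_tm.simps(2) [simp del] fvb.simps(3,5) [simp del]

lemma fvb_Alls: "fvb (Alls k \<phi>) = fvb \<phi> - k"
  by (induction k) (auto simp: Alls_def fvb.simps)

lemma fvb_closure [simp]: "fvb (closure \<phi>) = 0"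
  by (simp add: closure_def fvb_Alls)

lemma subst_tm_cong:
  "fvb_tm t \<le> k \<Longrightarrow> (\<And>i. i < k \<Longrightarrow> \<sigma> i = \<tau> i) \<Longrightarrow> subst_tm \<sigma> t = subst_tm \<tau> t"
  by (induction t) auto

lemma subst_cong:
  "fvb \<phi> \<le> k \<Longrightarrow> (\<And>i. i < k \<Longrightarrow> \<sigma> i = \<tau> i) \<Longrightarrow> subst \<sigma> \<phi> = subst \<tau> \<phi>"
proof (induction \<phi> arbitrary: k \<sigma> \<tau>)
  case (All \<phi>)
  have "subst (under \<sigma>) \<phi> = subst (under \<tau>) \<phi>"
    by (rule All.IH[where k = "Suc k"]) (use All.prems in \<open>auto simp: under_def split: nat.split\<close>)
  then show ?case by simp
next
  case (Imp \<phi> \<psi>)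
  then have "fvb \<phi> \<le> k" "fvb \<psi> \<le> k" by auto
  with Imp.IH Imp.prems(2) show ?case by (metis subst.simps(4))
next
  case (Eq s t)
  then show ?case using subst_tm_cong[of s k \<sigma> \<tau>] subst_tm_cong[of t k \<sigma> \<tau>] by simp
next
  case (Rel r ts)
  then show ?case using subst_tm_cong[of _ k \<sigma> \<tau>] by simp
qed simp

lemma subst_tm_Var: "subst_tm Var t = t"
  by (induction t) (auto intro: map_idI)

lemma under_Var: "under Var = Var"
  by (auto simp: under_def shift_tm_def split: nat.split)

lemma subst_Var: "subst Var \<phi> = \<phi>"
  by (induction \<phi>) (auto simp: subst_tm_Var under_Var intro: map_idI)

lemma subst_tm_subst_tm: "subst_tm \<sigma> (subst_tm \<tau> t) = subst_tm (\<lambda>i. subst_tm \<sigma> (\<tau> i)) t"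
  by (induction t) auto

lemma under_comp: "(\<lambda>i. subst_tm (under \<sigma>) (under \<tau> i)) = under (\<lambda>i. subst_tm \<sigma> (\<tau> i))"
  by (auto simp: under_def shift_tm_def subst_tm_subst_tm fun_eq_iff split: nat.split)

lemma subst_subst: "subst \<sigma> (subst \<tau> \<phi>) = subst (\<lambda>i. subst_tm \<sigma> (\<tau> i)) \<phi>"
  by (induction \<phi> arbitrary: \<sigma> \<tau>) (auto simp: subst_tm_subst_tm under_comp)

lemma subst_shift: "subst (under \<sigma>) (shift \<phi>) = shift (subst \<sigma> \<phi>)"
  by (simp add: shift_def subst_subst) (simp add: under_def shift_tm_def)

lemma inst_subst_under: "inst t (subst (under \<sigma>) \<phi>) = subst (case_nat t \<sigma>) \<phi>"
  by (auto simp: inst_def subst_subst under_def shift_tm_def subst_tm_subst_tm subst_tm_Var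
      intro!: arg_cong[where f = "\<lambda>s. subst s \<phi>"] split: nat.split)

lemma subst_inst: "subst \<sigma> (inst t \<phi>) = inst (subst_tm \<sigma> t) (subst (under \<sigma>) \<phi>)"
  by (auto simp: inst_subst_under) (auto simp: inst_def subst_subst
      intro!: arg_cong[where f = "\<lambda>s. subst s \<phi>"] split: nat.split)

lemma inst_tm_shift_tm [simp]: "subst_tm (\<lambda>i. case i of 0 \<Rightarrow> t | Suc j \<Rightarrow> Var j) (shift_tm s) = s"
  by (simp add: shift_tm_def subst_tm_subst_tm subst_tm_Var)

lemma fvb_tm_subst:
  "fvb_tm t \<le> m \<Longrightarrow> (\<And>i. i < m \<Longrightarrow> fvb_tm (\<sigma> i) \<le> k) \<Longrightarrow> fvb_tm (subst_tm \<sigma> t) \<le> k"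
  by (induction t) auto

lemma fvb_tm_shift_tm: "fvb_tm t \<le> k \<Longrightarrow> fvb_tm (shift_tm t) \<le> Suc k"
  unfolding shift_tm_def by (rule fvb_tm_subst) auto

lemma fvb_subst:
  "fvb \<phi> \<le> m \<Longrightarrow> (\<And>i. i < m \<Longrightarrow> fvb_tm (\<sigma> i) \<le> k) \<Longrightarrow> fvb (subst \<sigma> \<phi>) \<le> k"
proof (induction \<phi> arbitrary: m k \<sigma>)
  case (All \<phi>)
  have "fvb (subst (under \<sigma>) \<phi>) \<le> Suc k"
    by (rule All.IH[where m = "Suc m"])
      (use All.prems in \<open>auto simp: under_def fvb_tm_shift_tm split: nat.split\<close>)
  then show ?case by simp
qed (auto intro: fvb_tm_subst)

lemma in_lang_tm_subst:
  "in_lang_tm L t \<Longrightarrow> fvb_tm t \<le> m \<Longrightarrow> (\<And>i. i < m \<Longrightarrow> in_lang_tm L (\<sigma> i)) \<Longrightarrow> in_lang_tm L (subst_tm \<sigma> t)"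
  by (induction t) auto

lemma in_lang_tm_shift_tm: "in_lang_tm L t \<Longrightarrow> in_lang_tm L (shift_tm t)"
  unfolding shift_tm_def by (rule in_lang_tm_subst) auto

lemma in_lang_subst:
  "in_lang L \<phi> \<Longrightarrow> fvb \<phi> \<le> m \<Longrightarrow> (\<And>i. i < m \<Longrightarrow> in_lang_tm L (\<sigma> i)) \<Longrightarrow> in_lang L (subst \<sigma> \<phi>)"
proof (induction \<phi> arbitrary: m \<sigma>)
  case (All \<phi>)
  have "in_lang L (subst (under \<sigma>) \<phi>)"
    by (rule All.IH[where m = "Suc m"])
      (use All.prems in \<open>auto simp: under_def in_lang_tm_shift_tm split: nat.split\<close>)
  then show ?case by simp
qed (auto intro: in_lang_tm_subst)

lemma fvb_foldr_And_le:
  "fvb (foldr And \<psi>s \<chi>) \<le> k \<longleftrightarrow> (\<forall>\<psi> \<in> set \<psi>s. fvb \<psi> \<le> k) \<and> fvb \<chi> \<le> k"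
  by (induction \<psi>s) auto

lemma fvb_Exs_le: "fvb (Exs n \<phi>) \<le> k \<longleftrightarrow> fvb \<phi> \<le> n + k"
  by (induction n arbitrary: k) (auto simp: Exs_def)

lemma in_lang_foldr_And:
  "in_lang L (foldr And \<psi>s \<chi>) \<longleftrightarrow> (\<forall>\<psi> \<in> set \<psi>s. in_lang L \<psi>) \<and> in_lang L \<chi>"
  by (induction \<psi>s) auto

lemma in_lang_Exs: "in_lang L (Exs n \<phi>) \<longleftrightarrow> in_lang L \<phi>"
  by (induction n) (auto simp: Exs_def)

section \<open>Evaluation, substitution and soundness\<close>

lemma eval_tm_cong:
  "fvb_tm t \<le> k \<Longrightarrow> (\<And>i. i < k \<Longrightarrow> e i = e' i) \<Longrightarrow> eval_tm M e t = eval_tm M e' t"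
  by (induction t) (auto intro!: arg_cong[where f = "mfn M _"])

lemma holds_cong:
  "fvb \<phi> \<le> k \<Longrightarrow> (\<And>i. i < k \<Longrightarrow> e i = e' i) \<Longrightarrow> holds M e \<phi> \<longleftrightarrow> holds M e' \<phi>"
proof (induction \<phi> arbitrary: k e e')
  case (Eq s t)
  then show ?case using eval_tm_cong[of s k e e' M] eval_tm_cong[of t k e e' M] by simp
next
  case (Rel r ts)
  then have "map (eval_tm M e) ts = map (eval_tm M e') ts"
    by (auto intro!: eval_tm_cong[where k = k])
  then show ?case by (simp only: holds.simps)
next
  case (Imp \<phi> \<psi>)
  then have "holds M e \<phi> = holds M e' \<phi>" "holds M e \<psi> = holds M e' \<psi>"
    by (metis fvb.simps(4) max.bounded_iff)+
  then show ?case by simp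
next
  case (All \<phi>)
  have "holds M (case_nat a e) \<phi> = holds M (case_nat a e') \<phi>" for a
    by (rule All.IH[where k = "Suc k"]) (use All.prems in \<open>auto split: nat.split\<close>)
  then show ?case by simp
qed simp

lemma eval_subst_tm: "eval_tm M e (subst_tm \<sigma> t) = eval_tm M (\<lambda>i. eval_tm M e (\<sigma> i)) t"
  by (induction t) (auto intro!: arg_cong[where f = "mfn M _"])

lemma holds_subst: "holds M e (subst \<sigma> \<phi>) \<longleftrightarrow> holds M (\<lambda>i. eval_tm M e (\<sigma> i)) \<phi>"
proof (induction \<phi> arbitrary: e \<sigma>)
  case (All \<phi>)
  have "(\<lambda>i. eval_tm M (case_nat a e) (under \<sigma> i)) = case_nat a (\<lambda>i. eval_tm M e (\<sigma> i))" for a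
    by (auto simp: under_def shift_tm_def eval_subst_tm fun_eq_iff split: nat.split)
  then show ?case by (simp add: All.IH)
qed (auto simp: eval_subst_tm comp_def)

lemma holds_inst: "holds M e (inst t \<phi>) \<longleftrightarrow> holds M (case_nat (eval_tm M e t) e) \<phi>"
proof -
  have "(\<lambda>i. eval_tm M e (case i of 0 \<Rightarrow> t | Suc j \<Rightarrow> Var j)) = case_nat (eval_tm M e t) e"
    by (auto split: nat.split)
  then show ?thesis by (simp add: inst_def holds_subst)
qed

lemma holds_shift: "holds M (case_nat a e) (shift \<phi>) \<longleftrightarrow> holds M e \<phi>"
  by (simp add: shift_def holds_subst)

lemma holds_Alls:
  assumes "\<And>e. range e \<subseteq> mdom M \<Longrightarrow> holds M e (Alls k \<phi>)" and "range e \<subseteq> mdom M"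
  shows "holds M e \<phi>"
  using assms
proof (induction k arbitrary: e)
  case 0
  then show ?case by (simp add: Alls_def)
next
  case (Suc k)
  have "holds M e (Alls k \<phi>)" if e: "range e \<subseteq> mdom M" for e
  proof -
    \<comment> \<open>The outermost quantifier of \<open>Alls (Suc k) \<phi>\<close> receives the
      value \<open>e 0\<close>; the remaining environment must therefore be \<open>e\<close> moved
      down by one.\<close>
    have "holds M (e \<circ> Suc) (Alls (Suc k) \<phi>)" by (rule Suc.prems(1)) (use e in auto)
    then have "holds M (case_nat (e 0) (e \<circ> Suc)) (Alls k \<phi>)" using e by (auto simp: Alls_def)
    moreover have "case_nat (e 0) (e \<circ> Suc) = e" by (auto split: nat.split)
    ultimately show ?thesis by simp
  qed
  then show ?case using Suc by blast
qed

lemma holds_closure: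
  assumes "holds M e (closure \<phi>)" "range e' \<subseteq> mdom M"
  shows "holds M e' \<phi>"
proof -
  have "holds M e'' (closure \<phi>)" for e''
    using assms(1) holds_cong[of "closure \<phi>" 0 e e'' M] by simp
  then show ?thesis unfolding closure_def using assms(2) by (rule holds_Alls)
qed

text \<open>The rule \<open>AllE\<close> instantiates with arbitrary terms, including those with
  foreign symbols or wrong arities. Soundness therefore asks that the domain be closed under every
  symbol at every argument list, which is more than \<open>is_struct\<close> guarantees.\<close>

definition total_struct :: "('m, 'f, 'r) struct \<Rightarrow> bool" where
  "total_struct M \<longleftrightarrow>
     mdom M \<noteq> {} \<and> (\<forall>f xs. set xs \<subseteq> mdom M \<longrightarrow> mfn M f xs \<in> mdom M)"

lemma eval_tm_in_mdom: "total_struct M \<Longrightarrow> range e \<subseteq> mdom M \<Longrightarrow> eval_tm M e t \<in> mdom M"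
  by (induction t) (auto simp: total_struct_def image_subset_iff)

theorem soundness:
  "\<Gamma> \<turnstile> \<phi> \<Longrightarrow> total_struct M \<Longrightarrow> range e \<subseteq> mdom M \<Longrightarrow> (\<And>\<gamma>. \<gamma> \<in> \<Gamma> \<Longrightarrow> holds M e \<gamma>) \<Longrightarrow> holds M e \<phi>"
proof (induction arbitrary: e rule: proves.induct)
  case (AllI \<Gamma> \<phi>)
  have "holds M (case_nat a e) \<phi>" if "a \<in> mdom M" for a
    by (rule AllI.IH) (use AllI.prems that in \<open>auto simp: holds_shift image_subset_iff split: nat.split\<close>)
  then show ?case by simp
next
  case (AllE \<Gamma> \<phi> t)
  then show ?case using eval_tm_in_mdom[of M e t] by (auto simp: holds_inst)
next
  case (ImpI \<phi> \<Gamma> \<psi>)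
  then show ?case by auto
next
  case (Contr \<phi> \<Gamma>)
  then show ?case by fastforce
qed (auto simp: holds_inst)

section \<open>Completeness\<close>

instance tm :: (countable) countable
  by countable_datatype

instance fm :: (countable, countable) countable
  by countable_datatype

instance ar_fun :: countable
  by countable_datatype

instance ar_rel :: countable
  by countable_datatype

lemma proves_mono: "\<Gamma> \<turnstile> \<phi> \<Longrightarrow> \<Gamma> \<subseteq> \<Delta> \<Longrightarrow> \<Delta> \<turnstile> \<phi>"
proof (induction arbitrary: \<Delta> rule: proves.induct)
  case (ImpI \<phi> \<Gamma> \<psi>)
  then show ?case by (metis insert_mono proves.ImpI)
next
  case (Contr \<phi> \<Gamma>)
  then show ?case by (metis insert_mono proves.Contr)
next
  case (AllI \<Gamma> \<phi>)
  then show ?case by (metis image_mono proves.AllI)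
next
  case (EqSubst \<Gamma> s t \<phi>)
  then show ?case by (blast intro: proves.EqSubst[of \<Delta> s t])
next
  case (AllE \<Gamma> \<phi> t)
  then show ?case by (blast intro: proves.AllE)
next
  case (ImpE \<Gamma> \<phi> \<psi>)
  then show ?case by (blast intro: proves.ImpE[of \<Delta> \<phi>])
qed (blast intro: proves.Assm proves.EqRefl)+

text \<open>Substitution acts on context and conclusion alike. In the case \<open>AllI\<close> the
  lifted substitution fixes index 0 and commutes with \<open>shift\<close>, so the premise is again
  a derivation from a shifted context. The lemma serves to rename the variable used as a Henkin
  witness.\<close>

lemma proves_subst: "\<Gamma> \<turnstile> \<phi> \<Longrightarrow> subst \<sigma> ` \<Gamma> \<turnstile> subst \<sigma> \<phi>"
proof (induction arbitrary: \<sigma> rule: proves.induct)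
  case (Contr \<phi> \<Gamma>)
  then show ?case using proves.Contr[of "subst \<sigma> \<phi>"] by simp
next
  case (ImpI \<phi> \<Gamma> \<psi>)
  then show ?case using proves.ImpI[of "subst \<sigma> \<phi>"] by simp
next
  case (AllI \<Gamma> \<phi>)
  have "subst (under \<sigma>) ` shift ` \<Gamma> = shift ` subst \<sigma> ` \<Gamma>"
    by (simp add: image_image subst_shift)
  with AllI.IH[of "under \<sigma>"] show ?case by (simp add: proves.AllI)
next
  case (AllE \<Gamma> \<phi> t)
  then show ?case using proves.AllE[of _ "subst (under \<sigma>) \<phi>" "subst_tm \<sigma> t"] by (simp add: subst_inst)
next
  case (EqSubst \<Gamma> s t \<phi>)
  then show ?case
    using proves.EqSubst[of _ "subst_tm \<sigma> s" "subst_tm \<sigma> t" "subst (under \<sigma>) \<phi>"]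
    by (simp add: subst_inst)
next
  case (ImpE \<Gamma> \<phi> \<psi>)
  then show ?case using proves.ImpE[of _ "subst \<sigma> \<phi>"] by simp
qed (simp_all add: proves.Assm proves.EqRefl)

lemma proves_finite: "\<Gamma> \<turnstile> \<phi> \<Longrightarrow> \<exists>\<Delta> \<subseteq> \<Gamma>. finite \<Delta> \<and> \<Delta> \<turnstile> \<phi>"
proof (induction rule: proves.induct)
  case (Assm \<phi> \<Gamma>)
  then show ?case by (intro exI[of _ "{\<phi>}"]) (auto intro: proves.Assm)
next
  case (ImpI \<phi> \<Gamma> \<psi>)
  then obtain \<Delta> where "\<Delta> \<subseteq> insert \<phi> \<Gamma>" "finite \<Delta>" "\<Delta> \<turnstile> \<psi>" by blast
  then have "\<Delta> - {\<phi>} \<subseteq> \<Gamma>" "finite (\<Delta> - {\<phi>})" "insert \<phi> (\<Delta> - {\<phi>}) \<turnstile> \<psi>"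
    by (auto intro: proves_mono)
  then show ?case by (meson proves.ImpI)
next
  case (ImpE \<Gamma> \<phi> \<psi>)
  then obtain \<Delta> \<Delta>' where "\<Delta> \<subseteq> \<Gamma>" "finite \<Delta>" "\<Delta> \<turnstile> Imp \<phi> \<psi>" "\<Delta>' \<subseteq> \<Gamma>" "finite \<Delta>'" "\<Delta>' \<turnstile> \<phi>"
    by blast
  then show ?case
    using proves.ImpE[of "\<Delta> \<union> \<Delta>'" \<phi> \<psi>] proves_mono[of \<Delta> _ "\<Delta> \<union> \<Delta>'"] proves_mono[of \<Delta>' _ "\<Delta> \<union> \<Delta>'"]
    by (intro exI[of _ "\<Delta> \<union> \<Delta>'"]) simp
next
  case (Contr \<phi> \<Gamma>)
  then obtain \<Delta> where "\<Delta> \<subseteq> insert (Neg \<phi>) \<Gamma>" "finite \<Delta>" "\<Delta> \<turnstile> Falsum" by blast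
  then have "\<Delta> - {Neg \<phi>} \<subseteq> \<Gamma>" "finite (\<Delta> - {Neg \<phi>})" "insert (Neg \<phi>) (\<Delta> - {Neg \<phi>}) \<turnstile> Falsum"
    by (auto intro: proves_mono)
  then show ?case by (meson proves.Contr)
next
  case (AllI \<Gamma> \<phi>)
  then obtain \<Delta> where "\<Delta> \<subseteq> shift ` \<Gamma>" "finite \<Delta>" "\<Delta> \<turnstile> \<phi>" by blast
  then show ?case by (metis finite_subset_image proves.AllI)
next
  case (AllE \<Gamma> \<phi> t)
  then show ?case by (meson proves.AllE)
next
  case (EqRefl \<Gamma> t)
  then show ?case by (intro exI[of _ "{}"]) (auto intro: proves.EqRefl)
next
  case (EqSubst \<Gamma> s t \<phi>)
  then obtain \<Delta> \<Delta>' where "\<Delta> \<subseteq> \<Gamma>" "finite \<Delta>" "\<Delta> \<turnstile> Eq s t" "\<Delta>' \<subseteq> \<Gamma>" "finite \<Delta>'" "\<Delta>' \<turnstile> inst s \<phi>"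
    by blast
  then show ?case
    using proves.EqSubst[of "\<Delta> \<union> \<Delta>'" s t \<phi>] proves_mono[of \<Delta> _ "\<Delta> \<union> \<Delta>'"] proves_mono[of \<Delta>' _ "\<Delta> \<union> \<Delta>'"]
    by (intro exI[of _ "\<Delta> \<union> \<Delta>'"]) simp
qed

lemma proves_cut: "\<Gamma> \<turnstile> \<phi> \<Longrightarrow> insert \<phi> \<Gamma> \<turnstile> \<psi> \<Longrightarrow> \<Gamma> \<turnstile> \<psi>"
  by (meson proves.ImpI proves.ImpE)

lemma consistent_mono: "consistent \<Delta> \<Longrightarrow> \<Gamma> \<subseteq> \<Delta> \<Longrightarrow> consistent \<Gamma>"
  unfolding consistent_def using proves_mono by blast

lemma consistent_finite: "(\<And>\<Delta>. \<Delta> \<subseteq> \<Gamma> \<Longrightarrow> finite \<Delta> \<Longrightarrow> consistent \<Delta>) \<Longrightarrow> consistent \<Gamma>"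
  unfolding consistent_def using proves_finite by blast

text \<open>If the witness led to a contradiction, \<open>inst (Var x) \<psi>\<close> would be
  provable. Since \<open>x\<close> is not free in the context, the renaming that sends
  \<open>x\<close> to 0 and every other index up by one acts on the context as \<open>shift\<close>
  and turns the conclusion into \<open>\<psi>\<close>. Then \<open>AllI\<close> proves
  \<open>All \<psi>\<close>, against consistency.\<close>

lemma consistent_witness:
  assumes cons: "consistent (insert (Neg (All \<psi>)) \<Gamma>)"
    and fresh: "\<And>\<gamma>. \<gamma> \<in> insert (Neg (All \<psi>)) \<Gamma> \<Longrightarrow> fvb \<gamma> \<le> x"
  shows "consistent (insert (Neg (inst (Var x) \<psi>)) (insert (Neg (All \<psi>)) \<Gamma>))"
  unfolding consistent_def
proof
  let ?\<Gamma> = "insert (Neg (All \<psi>)) \<Gamma>"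
  let ?\<sigma> = "\<lambda>i. if i = x then Var 0 else Var (Suc i)"
  assume "insert (Neg (inst (Var x) \<psi>)) ?\<Gamma> \<turnstile> Falsum"
  then have "?\<Gamma> \<turnstile> inst (Var x) \<psi>" by (rule proves.Contr)
  then have "subst ?\<sigma> ` ?\<Gamma> \<turnstile> subst ?\<sigma> (inst (Var x) \<psi>)" by (rule proves_subst)
  moreover have "subst ?\<sigma> \<gamma> = shift \<gamma>" if "\<gamma> \<in> ?\<Gamma>" for \<gamma>
    unfolding shift_def using fresh[OF that] by (rule subst_cong) simp
  then have "subst ?\<sigma> ` ?\<Gamma> = shift ` ?\<Gamma>" by (rule image_cong[OF refl])
  moreover have "subst ?\<sigma> (inst (Var x) \<psi>) = \<psi>"
  proof -
    have "fvb \<psi> \<le> Suc x" using fresh[of "Neg (All \<psi>)"] by simp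
    then have "subst (\<lambda>i. subst_tm ?\<sigma> (case i of 0 \<Rightarrow> Var x | Suc j \<Rightarrow> Var j)) \<psi> = subst Var \<psi>"
      by (rule subst_cong) (auto split: nat.split)
    then show ?thesis by (simp add: inst_def subst_subst subst_Var)
  qed
  ultimately have "?\<Gamma> \<turnstile> All \<psi>" by (simp only: proves.AllI)
  then have "?\<Gamma> \<turnstile> Falsum" by (meson proves.Assm proves.ImpE insertI1)
  with cons show False by (simp add: consistent_def)
qed

text \<open>Free variables serve as Henkin constants.\<close>

definition fresh_var :: "('f, 'r) fm set \<Rightarrow> nat" where
  "fresh_var \<Gamma> = (LEAST k. \<forall>\<gamma> \<in> \<Gamma>. fvb \<gamma> \<le> k)"

definition henkin_step :: "('f, 'r) fm \<Rightarrow> ('f, 'r) fm set \<Rightarrow> ('f, 'r) fm set" where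
  "henkin_step \<phi> \<Gamma> = (if consistent (insert \<phi> \<Gamma>)
     then insert \<phi> \<Gamma> \<union> {Neg (inst (Var (fresh_var (insert \<phi> \<Gamma>))) \<psi>) | \<psi>. \<phi> = Neg (All \<psi>)}
     else \<Gamma>)"

primrec henkin_stage ::
  "('f::countable, 'r::countable) fm set \<Rightarrow> nat \<Rightarrow> ('f, 'r) fm set" where
  "henkin_stage \<Gamma> 0 = \<Gamma>"
| "henkin_stage \<Gamma> (Suc n) = henkin_step (from_nat n) (henkin_stage \<Gamma> n)"

text \<open>The bound on the free indices is carried along with consistency: it is what makes
  \<open>fresh_var\<close>, a least upper bound, meaningful at the next stage.\<close>

lemma henkin_step:
  assumes "consistent \<Gamma>" and "\<forall>\<gamma> \<in> \<Gamma>. fvb \<gamma> \<le> k"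
  shows "consistent (henkin_step \<phi> \<Gamma>) \<and> (\<exists>k. \<forall>\<gamma> \<in> henkin_step \<phi> \<Gamma>. fvb \<gamma> \<le> k)"
proof (cases "consistent (insert \<phi> \<Gamma>)")
  case True
  let ?x = "fresh_var (insert \<phi> \<Gamma>)"
  have "\<forall>\<gamma> \<in> insert \<phi> \<Gamma>. fvb \<gamma> \<le> max k (fvb \<phi>)" using assms(2) by auto
  then have x: "\<forall>\<gamma> \<in> insert \<phi> \<Gamma>. fvb \<gamma> \<le> ?x" unfolding fresh_var_def by (rule LeastI)
  show ?thesis
  proof (cases "\<exists>\<psi>. \<phi> = Neg (All \<psi>)")
    case True
    then obtain \<psi> where \<psi>: "\<phi> = Neg (All \<psi>)" by blast
    have eq: "henkin_step \<phi> \<Gamma> = insert (Neg (inst (Var ?x) \<psi>)) (insert \<phi> \<Gamma>)"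
      using \<open>consistent (insert \<phi> \<Gamma>)\<close> \<psi> by (auto simp: henkin_step_def)
    have "fvb \<gamma> \<le> max ?x (fvb (Neg (inst (Var ?x) \<psi>)))" if "\<gamma> \<in> henkin_step \<phi> \<Gamma>" for \<gamma>
      using that x unfolding eq by (auto simp del: fvb.simps simp: le_max_iff_disj)
    moreover have "consistent (henkin_step \<phi> \<Gamma>)"
      unfolding eq using consistent_witness[of \<psi> \<Gamma> ?x] x \<open>consistent (insert \<phi> \<Gamma>)\<close> \<psi> by blast
    ultimately show ?thesis by blast
  next
    case False
    then have "henkin_step \<phi> \<Gamma> = insert \<phi> \<Gamma>"
      using \<open>consistent (insert \<phi> \<Gamma>)\<close> by (auto simp: henkin_step_def)
    then show ?thesis using True x by metis
  qed
next
  case False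
  then show ?thesis using assms by (auto simp: henkin_step_def)
qed

lemma henkin_extension:
  fixes \<Gamma> :: "('f::countable, 'r::countable) fm set"
  assumes "consistent \<Gamma>" and "\<And>\<gamma>. \<gamma> \<in> \<Gamma> \<Longrightarrow> fvb \<gamma> \<le> k"
  obtains H where "\<Gamma> \<subseteq> H" "consistent H" "\<And>\<phi>. \<phi> \<notin> H \<Longrightarrow> Neg \<phi> \<in> H"
    "\<And>\<psi>. Neg (All \<psi>) \<in> H \<Longrightarrow> \<exists>t. Neg (inst t \<psi>) \<in> H"
proof -
  let ?S = "henkin_stage \<Gamma>"
  let ?H = "\<Union>n. ?S n"
  have stage: "consistent (?S n) \<and> (\<exists>k. \<forall>\<gamma> \<in> ?S n. fvb \<gamma> \<le> k)" for n
  proof (induction n)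
    case 0
    then show ?case using assms by auto
  next
    case (Suc n)
    then show ?case using henkin_step by (metis henkin_stage.simps(2))
  qed
  have "?S n \<subseteq> ?S (Suc n)" for n
    by (auto simp: henkin_step_def)
  then have mono: "?S m \<subseteq> ?S n" if "m \<le> n" for m n
    using that by (rule lift_Suc_mono_le)
  have cons: "consistent ?H"
  proof (rule consistent_finite)
    fix \<Delta> assume "\<Delta> \<subseteq> ?H" and "finite \<Delta>"
    from \<open>finite \<Delta>\<close> \<open>\<Delta> \<subseteq> ?H\<close> have "\<exists>n. \<Delta> \<subseteq> ?S n"
    proof (induction \<Delta>)
      case empty
      then show ?case by simp
    next
      case (insert \<delta> \<Delta>)
      then obtain m n where "\<Delta> \<subseteq> ?S n" "\<delta> \<in> ?S m" by auto
      then have "insert \<delta> \<Delta> \<subseteq> ?S (max m n)"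
        using mono[of m "max m n"] mono[of n "max m n"] by auto
      then show ?case by blast
    qed
    then show "consistent \<Delta>" using stage consistent_mono by blast
  qed
  \<comment> \<open>A formula is considered at the stage given by its own code. If it is consistent
    with the union, it is consistent with that stage and is accepted there.\<close>
  have max: "\<phi> \<in> ?H" if "consistent (insert \<phi> ?H)" for \<phi>
  proof -
    have "consistent (insert \<phi> (?S (to_nat \<phi>)))"
      using that by (rule consistent_mono) auto
    then have "\<phi> \<in> ?S (Suc (to_nat \<phi>))" by (simp add: henkin_step_def)
    then show ?thesis by blast
  qed
  show thesis
  proof
    show "\<Gamma> \<subseteq> ?H" using henkin_stage.simps(1)[of \<Gamma>] by blast
    show "consistent ?H" by (rule cons)
    show "Neg \<phi> \<in> ?H" if "\<phi> \<notin> ?H" for \<phi>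
    proof (rule max)
      have "insert \<phi> ?H \<turnstile> Falsum" using that max by (auto simp: consistent_def)
      then have "?H \<turnstile> Neg \<phi>" by (rule proves.ImpI)
      then show "consistent (insert (Neg \<phi>) ?H)"
        using cons proves_cut by (auto simp: consistent_def)
    qed
    show "\<exists>t. Neg (inst t \<psi>) \<in> ?H" if "Neg (All \<psi>) \<in> ?H" for \<psi>
    proof -
      let ?n = "to_nat (Neg (All \<psi>))"
      have "consistent (insert (Neg (All \<psi>)) (?S ?n))"
        using cons by (rule consistent_mono) (use that in auto)
      then have "Neg (inst (Var (fresh_var (insert (Neg (All \<psi>)) (?S ?n)))) \<psi>) \<in> ?S (Suc ?n)"
        by (auto simp: henkin_step_def)
      then show ?thesis by blast
    qed
  qed
qed

section \<open>Equality reasoning and the term model\<close>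

lemma proves_Eq_sym:
  assumes "\<Gamma> \<turnstile> Eq s t"
  shows "\<Gamma> \<turnstile> Eq t s"
  using proves.EqSubst[OF assms, of "Eq (Var 0) (shift_tm s)"] proves.EqRefl[of \<Gamma> s]
  by (simp add: inst_def)

lemma proves_Eq_trans:
  assumes "\<Gamma> \<turnstile> Eq s t" "\<Gamma> \<turnstile> Eq t u"
  shows "\<Gamma> \<turnstile> Eq s u"
  using proves.EqSubst[OF assms(2), of "Eq (shift_tm s) (Var 0)"] assms(1)
  by (simp add: inst_def)

text \<open>\<open>EqSubst\<close> replaces one term at a time. The prefix \<open>ps\<close>
  collects the arguments already replaced, which makes the induction on the remaining ones go
  through; \<open>proves_Fun_cong\<close> uses the same device.\<close>

lemma proves_Rel_cong:
  "list_all2 (\<lambda>s t. \<Gamma> \<turnstile> Eq s t) ss ts \<Longrightarrow> \<Gamma> \<turnstile> Rel r (ps @ ss) \<Longrightarrow> \<Gamma> \<turnstile> Rel r (ps @ ts)"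
proof (induction ss ts arbitrary: ps rule: list_all2_induct)
  case (Cons s ss t ts)
  have "\<Gamma> \<turnstile> Rel r (ps @ t # ss)"
    using proves.EqSubst[OF Cons(1), of "Rel r (map shift_tm ps @ Var 0 # map shift_tm ss)"] Cons.prems
    by (simp add: inst_def comp_def)
  then show ?case using Cons.IH[of "ps @ [t]"] by simp
qed simp

lemma proves_Fun_cong:
  "list_all2 (\<lambda>s t. \<Gamma> \<turnstile> Eq s t) ss ts \<Longrightarrow> \<Gamma> \<turnstile> Eq (Fun f (ps @ ss)) (Fun f (ps @ ts))"
proof (induction ss ts arbitrary: ps rule: list_all2_induct)
  case (Cons s ss t ts)
  have "\<Gamma> \<turnstile> Eq (Fun f (ps @ s # ss)) (Fun f (ps @ t # ss))"
    using proves.EqSubst[OF Cons(1), of "Eq (Fun f (map shift_tm (ps @ s # ss)))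
        (Fun f (map shift_tm ps @ Var 0 # map shift_tm ss))"] proves.EqRefl[of \<Gamma> "Fun f (ps @ s # ss)"]
    by (simp add: inst_def comp_def)
  moreover have "\<Gamma> \<turnstile> Eq (Fun f (ps @ t # ss)) (Fun f (ps @ t # ts))"
    using Cons.IH[of "ps @ [t]"] by simp
  ultimately show ?case by (rule proves_Eq_trans)
qed (simp add: proves.EqRefl)

text \<open>The elements of the term model are the least codes of the terms in each class, so that its
  domain is a set of natural numbers.\<close>

theorem model_existence:
  fixes \<Gamma> :: "('f::countable, 'r::countable) fm set"
  assumes "consistent \<Gamma>" and "\<And>\<gamma>. \<gamma> \<in> \<Gamma> \<Longrightarrow> fvb \<gamma> \<le> k"
  obtains M :: "(nat, 'f, 'r) struct" and e
  where "total_struct M" "range e \<subseteq> mdom M" "\<And>\<gamma>. \<gamma> \<in> \<Gamma> \<Longrightarrow> holds M e \<gamma>"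
proof -
  obtain H where H: "\<Gamma> \<subseteq> H" "consistent H" "\<And>\<phi>. \<phi> \<notin> H \<Longrightarrow> Neg \<phi> \<in> H"
    "\<And>\<psi>. Neg (All \<psi>) \<in> H \<Longrightarrow> \<exists>t. Neg (inst t \<psi>) \<in> H"
    using henkin_extension[OF assms] by metis
  have H_Neg: "Neg \<phi> \<in> H \<longleftrightarrow> \<phi> \<notin> H" for \<phi>
    using H(2,3) by (meson consistent_def proves.Assm proves.ImpE)
  have closed: "H \<turnstile> \<phi> \<longleftrightarrow> \<phi> \<in> H" for \<phi>
    using H(2,3) by (meson consistent_def proves.Assm proves.ImpE)
  define rep where "rep t = (LEAST n. H \<turnstile> Eq t (from_nat n))" for t :: "'f tm"
  define M :: "(nat, 'f, 'r) struct" where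
    "M = \<lparr>mdom = range rep, mfn = \<lambda>f xs. rep (Fun f (map from_nat xs)),
          mrel = \<lambda>r xs. Rel r (map from_nat xs) \<in> H\<rparr>"
  have dom: "mdom M = range rep" by (simp add: M_def)
  have rep: "H \<turnstile> Eq t (from_nat (rep t))" for t
    unfolding rep_def by (rule LeastI[of _ "to_nat t"]) (simp add: proves.EqRefl)
  have rep_eq: "rep s = rep t \<longleftrightarrow> H \<turnstile> Eq s t" for s t
  proof
    assume "rep s = rep t"
    then show "H \<turnstile> Eq s t" using rep by (metis proves_Eq_sym proves_Eq_trans)
  next
    assume "H \<turnstile> Eq s t"
    then have "H \<turnstile> Eq s u \<longleftrightarrow> H \<turnstile> Eq t u" for u
      by (meson proves_Eq_sym proves_Eq_trans)
    then show "rep s = rep t" by (simp add: rep_def)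
  qed
  have reps: "list_all2 (\<lambda>s t. H \<turnstile> Eq s t) ts (map (from_nat \<circ> rep) ts)" for ts
    using rep by (simp add: list_all2_conv_all_nth)
  have reps': "list_all2 (\<lambda>s t. H \<turnstile> Eq s t) (map (from_nat \<circ> rep) ts) ts" for ts
    using rep by (simp add: list_all2_conv_all_nth proves_Eq_sym)
  have eval: "eval_tm M (\<lambda>i. rep (\<sigma> i)) t = rep (subst_tm \<sigma> t)" for \<sigma> t
  proof (induction t)
    case (Fun f ts)
    then have "map (eval_tm M (\<lambda>i. rep (\<sigma> i))) ts = map rep (map (subst_tm \<sigma>) ts)" by simp
    then have "eval_tm M (\<lambda>i. rep (\<sigma> i)) (Fun f ts) =
        rep (Fun f (map (from_nat \<circ> rep) (map (subst_tm \<sigma>) ts)))"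
      by (simp only: eval_tm.simps) (simp add: M_def comp_assoc)
    also have "\<dots> = rep (Fun f (map (subst_tm \<sigma>) ts))"
      using proves_Fun_cong[of H _ _ f "[]", OF reps'[of "map (subst_tm \<sigma>) ts"]]
      by (simp add: rep_eq)
    finally show ?case by simp
  qed (simp add: M_def)
  \<comment> \<open>The truth lemma needs all substitutions \<sigma> at once: an environment of the
    term model is a choice of terms, and a quantifier prepends one more term to it.\<close>
  have truth: "holds M (\<lambda>i. rep (\<sigma> i)) \<phi> \<longleftrightarrow> subst \<sigma> \<phi> \<in> H" for \<sigma> \<phi>
  proof (induction \<phi> arbitrary: \<sigma>)
    case Falsum
    then show ?case using H(2) closed by (auto simp: consistent_def)
  next
    case (Eq s t)
    then show ?case by (simp add: eval rep_eq closed)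
  next
    case (Rel r ts)
    have "holds M (\<lambda>i. rep (\<sigma> i)) (Rel r ts) \<longleftrightarrow>
        Rel r (map (from_nat \<circ> rep) (map (subst_tm \<sigma>) ts)) \<in> H"
      unfolding holds.simps map_map comp_def eval by (simp add: M_def comp_def)
    also have "\<dots> \<longleftrightarrow> Rel r (map (subst_tm \<sigma>) ts) \<in> H"
      unfolding closed[symmetric]
      using proves_Rel_cong[of H _ _ r "[]", OF reps] proves_Rel_cong[of H _ _ r "[]", OF reps']
      by (metis append_Nil)
    finally show ?case by simp
  next
    case (Imp \<phi> \<psi>)
    have "Imp \<alpha> \<beta> \<in> H \<longleftrightarrow> (\<alpha> \<in> H \<longrightarrow> \<beta> \<in> H)" for \<alpha> \<beta>
    proof
      assume "Imp \<alpha> \<beta> \<in> H"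
      then show "\<alpha> \<in> H \<longrightarrow> \<beta> \<in> H" using closed by (meson proves.ImpE)
    next
      assume "\<alpha> \<in> H \<longrightarrow> \<beta> \<in> H"
      then have "insert \<alpha> H \<turnstile> \<beta>"
      proof (cases "\<alpha> \<in> H")
        case True
        then show ?thesis using \<open>\<alpha> \<in> H \<longrightarrow> \<beta> \<in> H\<close> by (simp add: proves.Assm)
      next
        case False
        then have "insert \<alpha> H \<turnstile> Falsum"
          using H_Neg by (meson insertCI proves.Assm proves.ImpE)
        then show ?thesis by (meson proves.Contr proves_mono subset_insertI)
      qed
      then show "Imp \<alpha> \<beta> \<in> H" using closed by (meson proves.ImpI)
    qed
    then show ?case using Imp by simp
  next
    case (All \<phi>)
    have env: "case_nat (rep t) (\<lambda>i. rep (\<sigma> i)) = (\<lambda>i. rep (case_nat t \<sigma> i))" for t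
      by (auto split: nat.split)
    have "holds M (\<lambda>i. rep (\<sigma> i)) (All \<phi>) \<longleftrightarrow> (\<forall>t. subst (case_nat t \<sigma>) \<phi> \<in> H)"
      by (simp add: dom env All.IH)
    also have "\<dots> \<longleftrightarrow> (\<forall>t. inst t (subst (under \<sigma>) \<phi>) \<in> H)"
      by (simp add: inst_subst_under)
    \<comment> \<open>Left to right uses the Henkin property: if the universal formula is missing,
      its negation belongs to \<open>H\<close>, and so does some negated instance.\<close>
    also have "\<dots> \<longleftrightarrow> All (subst (under \<sigma>) \<phi>) \<in> H"
      using closed H(4) H_Neg by (meson proves.AllE)
    finally show ?case by simp
  qed
  show thesis
  proof (rule that[of M "\<lambda>i. rep (Var i)"])
    show "total_struct M" by (auto simp: total_struct_def M_def)
    show "range (\<lambda>i. rep (Var i)) \<subseteq> mdom M" by (auto simp: M_def)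
    show "holds M (\<lambda>i. rep (Var i)) \<gamma>" if "\<gamma> \<in> \<Gamma>" for \<gamma>
      using truth[of Var \<gamma>] H(1) that by (auto simp: subst_Var)
  qed
qed

text \<open>The contrapositive of model existence for the context with the negated goal added. It
  replaces formal derivations in \<open>S12\<close> by arguments in its models.\<close>

corollary completeness:
  fixes \<Gamma> :: "('f::countable, 'r::countable) fm set"
  assumes "\<And>\<gamma>. \<gamma> \<in> insert \<phi> \<Gamma> \<Longrightarrow> fvb \<gamma> \<le> k"
    and "\<And>(M :: (nat, 'f, 'r) struct) e. total_struct M \<Longrightarrow> range e \<subseteq> mdom M \<Longrightarrow>
      (\<And>\<gamma>. \<gamma> \<in> \<Gamma> \<Longrightarrow> holds M e \<gamma>) \<Longrightarrow> holds M e \<phi>"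
  shows "\<Gamma> \<turnstile> \<phi>"
proof (rule ccontr)
  assume "\<not> \<Gamma> \<turnstile> \<phi>"
  then have "consistent (insert (Neg \<phi>) \<Gamma>)"
    unfolding consistent_def by (metis proves.Contr)
  moreover have "fvb \<gamma> \<le> k" if "\<gamma> \<in> insert (Neg \<phi>) \<Gamma>" for \<gamma>
    using that assms(1) by fastforce
  ultimately obtain M :: "(nat, 'f, 'r) struct" and e where
    "total_struct M" "range e \<subseteq> mdom M" "\<And>\<gamma>. \<gamma> \<in> insert (Neg \<phi>) \<Gamma> \<Longrightarrow> holds M e \<gamma>"
    using model_existence by blast
  then show False using assms(2)[of M e] by fastforce
qed

section \<open>Numerals\<close>

lemma in_lang_bnum: "in_lang_tm S12_lang (bnum n)"
proof (induction n rule: bnum.induct)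
  case (1 n)
  then show ?case by (subst bnum.simps) (auto simp: S12_lang_def)
qed

lemma fvb_bnum: "fvb_tm (bnum n) \<le> k"
proof (induction n rule: bnum.induct)
  case (1 n)
  then show ?case by (subst bnum.simps) auto
qed

lemma eval_bnum_cong: "eval_tm M e (bnum n) = eval_tm M e' (bnum n)"
  by (rule eval_tm_cong[OF fvb_bnum[of n 0]]) simp

lemma S12_model_BASIC:
  assumes "\<And>\<gamma>. \<gamma> \<in> S12 \<Longrightarrow> holds M e \<gamma>" "range e' \<subseteq> mdom M"
    and "\<phi> \<in> set (basic_axioms (Var 0) (Var 1) (Var 2) (Var 3))"
  shows "holds M e' \<phi>"
proof -
  have "closure \<phi> \<in> S12" using assms(3) by (auto simp: S12_def BASIC_def)
  then show ?thesis using assms(1,2) holds_closure by blast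
qed

text \<open>The connectives are abbreviations over \<open>Imp\<close>, \<open>Falsum\<close> and
  \<open>All\<close>; these equations recover their meaning without dissolving them. Since an
  \<open>Iff\<close> is literally an \<open>And\<close>, later proofs control the order of
  unfolding.\<close>

lemma holds_connectives:
  "holds M e (And \<phi> \<psi>) \<longleftrightarrow> holds M e \<phi> \<and> holds M e \<psi>"
  "holds M e (Or \<phi> \<psi>) \<longleftrightarrow> holds M e \<phi> \<or> holds M e \<psi>"
  "holds M e (Iff \<phi> \<psi>) \<longleftrightarrow> (holds M e \<phi> \<longleftrightarrow> holds M e \<psi>)"
  "holds M e (Ex \<phi>) \<longleftrightarrow> (\<exists>a \<in> mdom M. holds M (case_nat a e) \<phi>)"
  by auto

lemma basic_axioms_mem:
  "Iff (And (x \<preceq> y) (Neg (x \<doteq> y))) (tS x \<preceq> y) \<in> set (basic_axioms x y z u)"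
  "Or (y \<preceq> x) (x \<preceq> y) \<in> set (basic_axioms x y z u)"
  "Imp (And (x \<preceq> y) (y \<preceq> z)) (x \<preceq> z) \<in> set (basic_axioms x y z u)"
  "x \<oplus> tZ \<doteq> x \<in> set (basic_axioms x y z u)"
  "x \<oplus> tS y \<doteq> tS (x \<oplus> y) \<in> set (basic_axioms x y z u)"
  "x \<odot> tZ \<doteq> tZ \<in> set (basic_axioms x y z u)"
  "x \<odot> tS y \<doteq> x \<odot> y \<oplus> x \<in> set (basic_axioms x y z u)"
  unfolding basic_axioms_def list.set by (intro insertI1 insertI2)+

text \<open>A binary numeral evaluates to the \<open>n\<close>-fold successor of zero, and
  successors of different height differ because \<open>S x \<le> y\<close> means
  \<open>x \<le> y\<close> and \<open>x \<noteq> y\<close>. All inductions run over standard numbers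
  outside the model, so a few open axioms suffice: order, and the recursion equations of sum and
  product.\<close>

lemma S12_model_bnum_distinct:
  assumes tot: "total_struct M" and S12: "\<And>\<gamma>. \<gamma> \<in> S12 \<Longrightarrow> holds M e \<gamma>" and "n \<noteq> m"
  shows "eval_tm M e (bnum n) \<noteq> eval_tm M e (bnum m)"
proof -
  let ?D = "mdom M"
  let ?Z = "mfn M Zero []"
  let ?S = "\<lambda>x. mfn M Succ [x]"
  let ?P = "\<lambda>x y. mfn M Plus [x, y]"
  let ?T = "\<lambda>x y. mfn M Times [x, y]"
  let ?le = "\<lambda>x y. mrel M Leq [x, y]"
  let ?env = "\<lambda>x y z i::nat. if i = 0 then x else if i = Suc 0 then y else z"
  have ax: "holds M (?env x y z) \<phi>"
    if "x \<in> ?D" "y \<in> ?D" "z \<in> ?D" "\<phi> \<in> set (basic_axioms (Var 0) (Var 1) (Var 2) (Var 3))" for x y z \<phi>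
    by (rule S12_model_BASIC[OF S12]) (use that in auto)
  have D: "mfn M f xs \<in> ?D" if "set xs \<subseteq> ?D" for f xs
    using tot that by (simp add: total_struct_def)
  have less: "?le x y \<and> x \<noteq> y \<longleftrightarrow> ?le (?S x) y" if "x \<in> ?D" "y \<in> ?D" for x y
  proof -
    have "holds M (?env x y y) (Iff (And (Var 0 \<preceq> Var 1) (Neg (Var 0 \<doteq> Var 1))) (tS (Var 0) \<preceq> Var 1))"
      by (rule ax[OF that(1) that(2) that(2) basic_axioms_mem(1)])
    then show ?thesis unfolding holds_connectives(3) by simp
  qed
  have refl: "?le x x" if "x \<in> ?D" for x
  proof -
    have "holds M (?env x x x) (Or (Var 1 \<preceq> Var 0) (Var 0 \<preceq> Var 1))"
      by (rule ax[OF that that that basic_axioms_mem(2)])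
    then show ?thesis by simp
  qed
  have trans: "?le x z" if "x \<in> ?D" "y \<in> ?D" "z \<in> ?D" "?le x y" "?le y z" for x y z
  proof -
    have "holds M (?env x y z) (Imp (And (Var 0 \<preceq> Var 1) (Var 1 \<preceq> Var 2)) (Var 0 \<preceq> Var 2))"
      by (rule ax[OF that(1) that(2) that(3) basic_axioms_mem(3)])
    then show ?thesis using that by simp
  qed
  have add0: "?P x ?Z = x" if "x \<in> ?D" for x
  proof -
    have "holds M (?env x x x) (Var 0 \<oplus> tZ \<doteq> Var 0)"
      by (rule ax[OF that that that basic_axioms_mem(4)])
    then show ?thesis by simp
  qed
  have addS: "?P x (?S y) = ?S (?P x y)" if "x \<in> ?D" "y \<in> ?D" for x y
  proof -
    have "holds M (?env x y y) (Var 0 \<oplus> tS (Var 1) \<doteq> tS (Var 0 \<oplus> Var 1))"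
      by (rule ax[OF that(1) that(2) that(2) basic_axioms_mem(5)])
    then show ?thesis by simp
  qed
  have mul0: "?T x ?Z = ?Z" if "x \<in> ?D" for x
  proof -
    have "holds M (?env x x x) (Var 0 \<odot> tZ \<doteq> tZ)"
      by (rule ax[OF that that that basic_axioms_mem(6)])
    then show ?thesis by simp
  qed
  have mulS: "?T x (?S y) = ?P (?T x y) x" if "x \<in> ?D" "y \<in> ?D" for x y
  proof -
    have "holds M (?env x y y) (Var 0 \<odot> tS (Var 1) \<doteq> Var 0 \<odot> Var 1 \<oplus> Var 0)"
      by (rule ax[OF that(1) that(2) that(2) basic_axioms_mem(7)])
    then show ?thesis by simp
  qed
  define s where "s n = (?S ^^ n) ?Z" for n
  have s0: "s 0 = ?Z" and sS: "s (Suc n) = ?S (s n)" for n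
    by (simp_all add: s_def)
  have sD: "s n \<in> ?D" for n
    by (induction n) (auto simp: s0 sS D)
  \<comment> \<open>Numerals double by multiplying with two on the left, while the product recurs on
    its right argument. Hence this external induction, adding two at each step.\<close>
  have double: "?T (?S (?S ?Z)) (s n) = s (2 * n)" for n
  proof (induction n)
    case 0
    then show ?case by (simp add: s0 mul0 D)
  next
    case (Suc n)
    have "?P (s (2 * n)) (?S (?S ?Z)) = ?S (?S (s (2 * n)))"
      using sD by (simp add: addS add0 D)
    then show ?case using sD by (simp add: sS mulS D Suc)
  qed
  have val: "eval_tm M e (bnum n) = s n" for n
  proof (induction n rule: bnum.induct)
    case (1 n)
    have "2 * (n div 2) = n" if "even n" using that by simp
    moreover have "Suc (2 * (n div 2)) = n" if "odd n" using that by simp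
    ultimately show ?case
      using 1 by (subst bnum.simps) (auto simp: s0 double sS[symmetric])
  qed
  have "?le (s (Suc a)) (s b)" if "a < b" for a b
    using that
  proof (induction b)
    case (Suc b)
    have "?le (s b) (s (Suc b))"
      using less[OF sD sD, of b "Suc b"] refl[OF sD[of "Suc b"]] by (simp add: sS)
    then show ?case using Suc refl[OF sD[of "Suc b"]] trans[OF sD sD sD]
      by (metis less_SucE)
  qed simp
  then have "s a \<noteq> s b" if "a < b" for a b
    using less[OF sD sD] that sS by metis
  then have "s n \<noteq> s m" using \<open>n \<noteq> m\<close> by (metis nat_neq_iff)
  then show ?thesis by (simp add: val)
qed

lemma fvb_S12: "\<gamma> \<in> S12 \<Longrightarrow> fvb \<gamma> = 0"
  by (auto simp: S12_def BASIC_def)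

lemma S12_proves:
  assumes "sentence S12_lang \<phi>"
    and "\<And>(M :: (nat, ar_fun, ar_rel) struct) e. total_struct M \<Longrightarrow>
      (\<And>e \<gamma>. \<gamma> \<in> S12 \<Longrightarrow> holds M e \<gamma>) \<Longrightarrow> range e \<subseteq> mdom M \<Longrightarrow> holds M e \<phi>"
  shows "S12 \<turnstile> \<phi>"
proof (rule completeness)
  show "fvb \<gamma> \<le> 0" if "\<gamma> \<in> insert \<phi> S12" for \<gamma>
    using that assms(1) fvb_S12 by (auto simp: sentence_def)
  fix M :: "(nat, ar_fun, ar_rel) struct" and e
  assume M: "total_struct M" "range e \<subseteq> mdom M" "\<And>\<gamma>. \<gamma> \<in> S12 \<Longrightarrow> holds M e \<gamma>"
  have "holds M e' \<gamma>" if "\<gamma> \<in> S12" for e' \<gamma>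
    using M(3)[OF that] holds_cong[of \<gamma> 0 e e' M] fvb_S12[OF that] by simp
  then show "holds M e \<phi>" using assms(2) M by blast
qed

lemma sentence_bnum:
  "sentence S12_lang (Ex (Eq (Var 0) (bnum n)))"
  "sentence S12_lang (All (Imp (Eq (Var 0) (bnum n)) (Neg (Eq (Var 0) (bnum m)))))"
  "sentence S12_lang (All (All (Imp (Eq (Var 1) (bnum n))
     (Iff (Eq (Var 0) (bnum n)) (Eq (Var 0) (Var 1))))))"
  using fvb_bnum[of n 0] fvb_bnum[of m 0]
  by (auto simp: sentence_def in_lang_bnum fvb.simps fvb_tm.simps)

lemma S12_proves_bnum_ex: "S12 \<turnstile> Ex (Eq (Var 0) (bnum n))"
proof (rule S12_proves[OF sentence_bnum(1)])
  fix M :: "(nat, ar_fun, ar_rel) struct" and e :: "nat \<Rightarrow> nat"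
  assume "total_struct M" "range e \<subseteq> mdom M"
  then have "eval_tm M e (bnum n) \<in> mdom M" by (rule eval_tm_in_mdom)
  moreover have "eval_tm M (case_nat a e) (bnum n) = eval_tm M e (bnum n)" for a
    by (rule eval_bnum_cong)
  ultimately show "holds M e (Ex (Eq (Var 0) (bnum n)))" by auto
qed

lemma S12_proves_bnum_distinct:
  assumes "n \<noteq> m"
  shows "S12 \<turnstile> All (Imp (Eq (Var 0) (bnum n)) (Neg (Eq (Var 0) (bnum m))))"
proof (rule S12_proves[OF sentence_bnum(2)])
  fix M :: "(nat, ar_fun, ar_rel) struct" and e :: "nat \<Rightarrow> nat"
  assume "total_struct M" "\<And>e \<gamma>. \<gamma> \<in> S12 \<Longrightarrow> holds M e \<gamma>"
  then have "eval_tm M e (bnum n) \<noteq> eval_tm M e (bnum m)" for e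
    using S12_model_bnum_distinct assms by blast
  then show "holds M e (All (Imp (Eq (Var 0) (bnum n)) (Neg (Eq (Var 0) (bnum m)))))"
    by simp metis
qed

text \<open>Under the interpretation, this lets any fixed representative of a numeral stand in for
  the numeral itself. The liar formula can thus be handed its own code as an argument, which it
  could not contain.\<close>

lemma S12_proves_bnum_eq:
  "S12 \<turnstile> All (All (Imp (Eq (Var 1) (bnum n)) (Iff (Eq (Var 0) (bnum n)) (Eq (Var 0) (Var 1)))))"
  by (rule S12_proves[OF sentence_bnum(3)]) auto

section \<open>Semantics and syntax of translated equations\<close>

lemma holds_tr_Eq:
  "holds M e (tr N (Eq s t)) \<longleftrightarrow> (\<exists>a \<in> mdom M. \<exists>b \<in> mdom M.
     holds M (case_nat a e) (tr_tm N s) \<and> holds M (case_nat b e) (tr_tm N t) \<and>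
     holds M (case_nat a (case_nat b e)) (ieq N))"
proof -
  have env: "(\<lambda>i. eval_tm M (case_nat a (case_nat b e)) (case i of 0 \<Rightarrow> Var c | Suc j \<Rightarrow> Var (Suc (Suc j))))
      = case_nat (case_nat a (case_nat b e) c) e" for a b c
    by (auto split: nat.split)
  show ?thesis
    by (simp add: numeral_2_eq_2 Exs_def place_def holds_subst env) blast
qed

lemma tr_tm_syntax:
  assumes "interp_ok N LV L"
  shows "in_lang_tm LV t \<Longrightarrow> fvb_tm t \<le> k \<Longrightarrow> fvb (tr_tm N t) \<le> Suc k \<and> in_lang L (tr_tm N t)"
proof (induction t)
  case (Var i)
  then show ?case using assms by (auto simp: interp_ok_def)
next
  case (Fun g ts)
  have idom: "fvb (idom N) \<le> Suc k" "in_lang L (idom N)"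
    using assms by (auto simp: interp_ok_def)
  have ifn: "fvb (ifn N g (length ts)) \<le> Suc (length ts)" "in_lang L (ifn N g (length ts))"
    using assms Fun.prems by (auto simp: interp_ok_def)
  have IH: "fvb (tr_tm N t) \<le> Suc k" "in_lang L (tr_tm N t)" if "t \<in> set ts" for t
    using Fun that by auto
  \<comment> \<open>Below the quantifiers the values of the arguments are the indices under
    \<open>length ts\<close> and the value of the whole term is index \<open>length ts\<close>. The
    old variables start one later, whence the offset \<open>Suc (length ts)\<close>.\<close>
  have "fvb \<psi> \<le> length ts + Suc k \<and> in_lang L \<psi>"
    if "\<psi> \<in> set (place (Suc (length ts)) (map (tr_tm N) ts))" for \<psi>
  proof -
    from that obtain i where i: "i < length ts" and \<psi>: "\<psi> = subst (\<lambda>n. case n of 0 \<Rightarrow> Var i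
        | Suc j \<Rightarrow> Var (j + Suc (length ts))) (tr_tm N (ts ! i))"
      by (auto simp: place_def in_set_enumerate_eq)
    have "fvb \<psi> \<le> length ts + Suc k"
      unfolding \<psi> by (rule fvb_subst[OF IH(1)]) (use i in \<open>auto split: nat.split\<close>)
    moreover have "in_lang L \<psi>"
      unfolding \<psi> by (rule in_lang_subst[OF IH(2) IH(1)]) (use i in \<open>auto split: nat.split\<close>)
    ultimately show ?thesis by simp
  qed
  then show ?case
    using idom ifn by (auto simp: fvb_Exs_le fvb_foldr_And_le in_lang_Exs in_lang_foldr_And)
qed

lemma tr_Eq_syntax:
  assumes "interp_ok N LV L" "in_lang_tm LV s" "in_lang_tm LV t" "fvb_tm s \<le> k" "fvb_tm t \<le> k"
  shows "fvb (tr N (Eq s t)) \<le> k \<and> in_lang L (tr N (Eq s t))"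
proof -
  have s: "fvb (tr_tm N s) \<le> Suc k" "in_lang L (tr_tm N s)"
    and t: "fvb (tr_tm N t) \<le> Suc k" "in_lang L (tr_tm N t)"
    using tr_tm_syntax assms by blast+
  have ieq: "fvb (ieq N) \<le> 2 + k" "in_lang L (ieq N)"
    using assms(1) by (auto simp: interp_ok_def)
  have "fvb \<psi> \<le> 2 + k \<and> in_lang L \<psi>" if "\<psi> \<in> set (place 2 [tr_tm N s, tr_tm N t])" for \<psi>
  proof -
    define f where
      "f i u = subst (\<lambda>n. case n of 0 \<Rightarrow> Var i | Suc j \<Rightarrow> Var (Suc (Suc j))) (tr_tm N u)" for i u
    have "\<psi> = f 0 s \<or> \<psi> = f (Suc 0) t"
      using that by (auto simp: place_def f_def)
    then obtain i u where i: "i < 2" and u: "u = s \<or> u = t" and "\<psi> = f i u"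
      by (metis lessI zero_less_numeral numeral_2_eq_2)
    then have \<psi>: "\<psi> = subst (\<lambda>n. case n of 0 \<Rightarrow> Var i | Suc j \<Rightarrow> Var (Suc (Suc j))) (tr_tm N u)"
      by (simp add: f_def)
    have u': "fvb (tr_tm N u) \<le> Suc k" "in_lang L (tr_tm N u)"
      using s t u by auto
    have "fvb \<psi> \<le> 2 + k"
      unfolding \<psi> by (rule fvb_subst[OF u'(1)]) (use i in \<open>auto split: nat.split\<close>)
    moreover have "in_lang L \<psi>"
      unfolding \<psi> by (rule in_lang_subst[OF u'(2) u'(1)]) (use i in \<open>auto split: nat.split\<close>)
    ultimately show ?thesis by simp
  qed
  then show ?thesis
    using ieq by (simp add: fvb_Exs_le fvb_foldr_And_le in_lang_Exs in_lang_foldr_And del: foldr.simps)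
qed

section \<open>Sets and pairs in sequential theories\<close>

definition mem_fm :: "(as_rel \<Rightarrow> nat \<Rightarrow> ('f, 'r) fm) \<Rightarrow> nat \<Rightarrow> nat \<Rightarrow> ('f, 'r) fm" where
  "mem_fm G i j = subst (\<lambda>n. if n = 0 then Var i else Var j) (G Mem 2)"

text \<open>Kuratowski pairs: index 0 is a pair of the indices 1 and 2. Extensionality is not available,
  so pairs are not unique.\<close>

definition pair_fm :: "(as_rel \<Rightarrow> nat \<Rightarrow> ('f, 'r) fm) \<Rightarrow> ('f, 'r) fm" where
  "pair_fm G = Ex (Ex (And
     (All (Iff (mem_fm G 0 3) (Or (Eq (Var 0) (Var 2)) (Eq (Var 0) (Var 1)))))
     (And (All (Iff (mem_fm G 0 2) (Eq (Var 0) (Var 4))))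
          (All (Iff (mem_fm G 0 1) (Or (Eq (Var 0) (Var 4)) (Eq (Var 0) (Var 5))))))))"

definition pair_at ::
  "(as_rel \<Rightarrow> nat \<Rightarrow> ('f, 'r) fm) \<Rightarrow> nat \<Rightarrow> nat \<Rightarrow> nat \<Rightarrow> ('f, 'r) fm" where
  "pair_at G i j k =
     subst (\<lambda>n. if n = 0 then Var i else if n = 1 then Var j else Var k) (pair_fm G)"

text \<open>Index 2 codes a binary relation that holds of the indices 0 and 1.\<close>

definition rel_fm :: "(as_rel \<Rightarrow> nat \<Rightarrow> ('f, 'r) fm) \<Rightarrow> ('f, 'r) fm" where
  "rel_fm G = Ex (And (mem_fm G 0 3) (pair_fm G))"

lemma fvb_mem_fm: "fvb (G Mem 2) \<le> 2 \<Longrightarrow> fvb (mem_fm G i j) \<le> max (Suc i) (Suc j)"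
  unfolding mem_fm_def by (erule fvb_subst) (auto simp: fvb_tm.simps)

lemma in_lang_mem_fm: "in_lang L (G Mem 2) \<Longrightarrow> in_lang L (mem_fm G i j)"
  unfolding mem_fm_def by (erule in_lang_subst[OF _ order_refl]) auto

lemma fvb_pair_fm: "fvb (G Mem 2) \<le> 2 \<Longrightarrow> fvb (pair_fm G) \<le> 3"
  unfolding pair_fm_def
  using fvb_mem_fm[of G 0 3] fvb_mem_fm[of G 0 2] fvb_mem_fm[of G 0 1] by auto

lemma in_lang_pair_fm: "in_lang L (G Mem 2) \<Longrightarrow> in_lang L (pair_fm G)"
  by (simp add: pair_fm_def in_lang_mem_fm)

lemma fvb_pair_at: "fvb (G Mem 2) \<le> 2 \<Longrightarrow> fvb (pair_at G i j k) \<le> Max {Suc i, Suc j, Suc k}"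
  unfolding pair_at_def by (rule fvb_subst[OF fvb_pair_fm]) (auto simp: fvb_tm.simps)

lemma in_lang_pair_at: "in_lang L (G Mem 2) \<Longrightarrow> in_lang L (pair_at G i j k)"
  unfolding pair_at_def by (rule in_lang_subst[OF in_lang_pair_fm order_refl]) auto

lemma fvb_rel_fm: "fvb (G Mem 2) \<le> 2 \<Longrightarrow> fvb (rel_fm G) \<le> 3"
  unfolding rel_fm_def using fvb_mem_fm[of G 0 3] fvb_pair_fm[of G] by auto

lemma in_lang_rel_fm: "in_lang L (G Mem 2) \<Longrightarrow> in_lang L (rel_fm G)"
  by (simp add: rel_fm_def in_lang_mem_fm in_lang_pair_fm)

lemma total_struct_env: "total_struct M \<Longrightarrow> \<exists>e :: nat \<Rightarrow> 'm. range e \<subseteq> mdom M"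
  for M :: "('m, 'f, 'r) struct"
proof -
  assume "total_struct M"
  then obtain x where "x \<in> mdom M" by (auto simp: total_struct_def)
  then show ?thesis by (intro exI[of _ "\<lambda>_. x"]) auto
qed

lemma num_fm_syntax:
  assumes "interp_ok N S12_lang L"
  shows "fvb (num_fm N n) \<le> 1" "in_lang L (num_fm N n)"
  using tr_Eq_syntax[OF assms, of "Var 0" "bnum n" 1] in_lang_bnum fvb_bnum[of n 1]
  by (simp_all add: num_fm_def fvb_tm.simps)

text \<open>The models are those supplied by the term construction: total, so that soundness
  applies, and with natural numbers as elements, so that an element can later serve as an offset for
  a variable index.\<close>

locale arith_model =
  fixes L :: "(nat, nat) lang" and U :: "(nat, nat) fm set" and N :: arith_interp
    and G :: "as_rel \<Rightarrow> nat \<Rightarrow> (nat, nat) fm" and M :: "(nat, nat, nat) struct"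
  assumes total: "total_struct M"
    and model: "\<And>\<phi> e. \<phi> \<in> U \<Longrightarrow> range e \<subseteq> mdom M \<Longrightarrow> holds M e \<phi>"
    and seq: "direct_interpretation G AS_lang AS L U"
    and interp: "relative_interpretation N S12_lang S12 L U"
begin

definition mem :: "nat \<Rightarrow> nat \<Rightarrow> bool" where
  "mem x y \<longleftrightarrow> holds M (case_nat x (\<lambda>_. y)) (G Mem 2)"

definition is_pair :: "nat \<Rightarrow> nat \<Rightarrow> nat \<Rightarrow> bool" where
  "is_pair p x y \<longleftrightarrow> (\<exists>u \<in> mdom M. \<exists>v \<in> mdom M.
     (\<forall>w \<in> mdom M. mem w p \<longleftrightarrow> w = u \<or> w = v) \<and>
     (\<forall>w \<in> mdom M. mem w u \<longleftrightarrow> w = x) \<and>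
     (\<forall>w \<in> mdom M. mem w v \<longleftrightarrow> w = x \<or> w = y))"

lemma holds_theorem: "U \<turnstile> \<phi> \<Longrightarrow> range e \<subseteq> mdom M \<Longrightarrow> holds M e \<phi>"
  using soundness total model by blast

lemma in_lang_Mem: "in_lang L (G Mem 2)" and fvb_Mem: "fvb (G Mem 2) \<le> 2"
  using seq by (auto simp: direct_interpretation_def AS_lang_def)

lemma holds_Mem: "holds M e (G Mem 2) \<longleftrightarrow> mem (e 0) (e 1)"
  unfolding mem_def by (rule holds_cong[OF fvb_Mem]) (auto simp: less_2_cases_iff)

lemma holds_mem_fm [simp]: "holds M e (mem_fm G i j) \<longleftrightarrow> mem (e i) (e j)"
  by (simp add: mem_fm_def holds_subst holds_Mem)

lemma holds_tr_Mem: "holds M e (direct_tr G (Rel Mem [Var i, Var j])) \<longleftrightarrow> mem (e i) (e j)"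
  by (simp add: holds_subst numeral_2_eq_2[symmetric] holds_Mem)

lemma empty_ex: "\<exists>x \<in> mdom M. \<forall>y \<in> mdom M. \<not> mem y x"
proof -
  obtain e :: "nat \<Rightarrow> nat" where e: "range e \<subseteq> mdom M"
    using total_struct_env[OF total] by blast
  have "U \<turnstile> direct_tr G (Ex (All (Neg (Rel Mem [Var 0, Var 1]))))"
    using seq by (simp add: direct_interpretation_def AS_def)
  from holds_theorem[OF this e] show ?thesis
    by (simp del: direct_tr.simps(3) add: holds_tr_Mem)
qed

lemma adjoin_ex:
  assumes "x \<in> mdom M" "y \<in> mdom M"
  shows "\<exists>z \<in> mdom M. \<forall>w \<in> mdom M. mem w z \<longleftrightarrow> mem w x \<or> w = y"
proof -
  have "U \<turnstile> direct_tr G (All (All (Ex (All (Iff (Rel Mem [Var 0, Var 1])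
                                (Or (Rel Mem [Var 0, Var 3]) (Eq (Var 0) (Var 2))))))))"
    using seq by (simp add: direct_interpretation_def AS_def)
  from holds_theorem[OF this, of "\<lambda>_. x"] assms show ?thesis
    unfolding direct_tr.simps(1,2,4,5) holds_connectives(3,4) holds.simps(5) holds_connectives(2)
    by (simp del: direct_tr.simps add: holds_tr_Mem)
qed

lemma finite_set_ex: "finite A \<Longrightarrow> A \<subseteq> mdom M \<Longrightarrow> \<exists>z \<in> mdom M. \<forall>w \<in> mdom M. mem w z \<longleftrightarrow> w \<in> A"
proof (induction A rule: finite_induct)
  case empty
  then show ?case using empty_ex by simp
next
  case (insert a A)
  then obtain x where "x \<in> mdom M" "\<forall>w \<in> mdom M. mem w x \<longleftrightarrow> w \<in> A" by auto
  with adjoin_ex[of x a] insert.prems show ?case by auto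
qed

lemma holds_pair_fm: "holds M e (pair_fm G) \<longleftrightarrow> is_pair (e 0) (e 1) (e 2)"
  unfolding pair_fm_def is_pair_def holds_connectives(4) holds_connectives(1)
  unfolding holds_connectives(3) holds.simps(5) holds_connectives(2)
  by (simp add: numeral_eq_Suc)

lemma holds_pair_at: "holds M e (pair_at G i j k) \<longleftrightarrow> is_pair (e i) (e j) (e k)"
  by (simp add: pair_at_def holds_subst holds_pair_fm)

lemma is_pair_ex:
  assumes "x \<in> mdom M" "y \<in> mdom M"
  shows "\<exists>p \<in> mdom M. is_pair p x y"
proof -
  obtain u where u: "u \<in> mdom M" "\<forall>w \<in> mdom M. mem w u \<longleftrightarrow> w \<in> {x}"
    using finite_set_ex[of "{x}"] assms by auto
  obtain v where v: "v \<in> mdom M" "\<forall>w \<in> mdom M. mem w v \<longleftrightarrow> w \<in> {x, y}"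
    using finite_set_ex[of "{x, y}"] assms by auto
  obtain p where p: "p \<in> mdom M" "\<forall>w \<in> mdom M. mem w p \<longleftrightarrow> w \<in> {u, v}"
    using finite_set_ex[of "{u, v}"] u v by auto
  show ?thesis unfolding is_pair_def using u v p by auto
qed

text \<open>Kuratowski's argument survives the lack of extensionality. The members of
  \<open>p\<close> are exactly two given elements, so the witnesses of both readings agree as
  elements up to order, and their members determine first \<open>x\<close> and then
  \<open>y\<close>.\<close>

lemma is_pair_inj:
  assumes "is_pair p x y" "is_pair p x' y'"
    and D: "x \<in> mdom M" "y \<in> mdom M" "x' \<in> mdom M" "y' \<in> mdom M"
  shows "x = x' \<and> y = y'"
proof -
  let ?D = "mdom M"
  obtain u v where uv: "u \<in> ?D" "v \<in> ?D" "\<forall>w \<in> ?D. mem w p \<longleftrightarrow> w = u \<or> w = v"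
    "\<forall>w \<in> ?D. mem w u \<longleftrightarrow> w = x" "\<forall>w \<in> ?D. mem w v \<longleftrightarrow> w = x \<or> w = y"
    using assms(1) by (auto simp: is_pair_def)
  obtain u' v' where uv': "u' \<in> ?D" "v' \<in> ?D" "\<forall>w \<in> ?D. mem w p \<longleftrightarrow> w = u' \<or> w = v'"
    "\<forall>w \<in> ?D. mem w u' \<longleftrightarrow> w = x'" "\<forall>w \<in> ?D. mem w v' \<longleftrightarrow> w = x' \<or> w = y'"
    using assms(2) by (auto simp: is_pair_def)
  have "u' = u \<or> u' = v" "u = u' \<or> u = v'" "v = u' \<or> v = v'" "v' = u \<or> v' = v"
    using uv uv' by blast+
  moreover have x: "x = x'"
    using uv uv' D \<open>u' = u \<or> u' = v\<close> \<open>u = u' \<or> u = v'\<close> by metis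
  ultimately have "y = y'"
    using uv(4,5) uv'(4,5) D by metis
  with x show ?thesis by simp
qed

lemma holds_rel_fm:
  "holds M e (rel_fm G) \<longleftrightarrow> (\<exists>p \<in> mdom M. mem p (e 2) \<and> is_pair p (e 0) (e 1))"
  unfolding rel_fm_def holds_connectives(1,4) by (simp add: holds_pair_fm numeral_eq_Suc)

text \<open>One pair is chosen for each element of \<open>Q\<close>, and \<open>c\<close> collects
  the chosen ones. Other pairs of the same components may lie outside \<open>c\<close>, but one
  inside is enough, and \<open>is_pair_inj\<close> rules out unwanted readings.\<close>

lemma finite_rel_ex:
  assumes "finite Q" "Q \<subseteq> mdom M \<times> mdom M"
  shows "\<exists>c \<in> mdom M. \<forall>x \<in> mdom M. \<forall>y \<in> mdom M. (\<exists>p \<in> mdom M. mem p c \<and> is_pair p x y) \<longleftrightarrow> (x, y) \<in> Q"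
proof -
  have "\<exists>p \<in> mdom M. is_pair p (fst q) (snd q)" if "q \<in> Q" for q
    using is_pair_ex assms(2) that by auto
  then obtain p where p: "\<And>q. q \<in> Q \<Longrightarrow> p q \<in> mdom M \<and> is_pair (p q) (fst q) (snd q)"
    by metis
  obtain c where c: "c \<in> mdom M" "\<forall>w \<in> mdom M. mem w c \<longleftrightarrow> w \<in> p ` Q"
    using finite_set_ex[of "p ` Q"] assms(1) p by (meson finite_imageI image_subsetI)
  have "(\<exists>p \<in> mdom M. mem p c \<and> is_pair p x y) \<longleftrightarrow> (x, y) \<in> Q" if "x \<in> mdom M" "y \<in> mdom M" for x y
  proof
    assume "\<exists>p \<in> mdom M. mem p c \<and> is_pair p x y"
    then obtain w where "w \<in> p ` Q" "is_pair w x y" using c(2) by auto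
    then obtain q where q: "q \<in> Q" "is_pair (p q) x y" by blast
    then have "x = fst q \<and> y = snd q"
      using is_pair_inj[of "p q" x y "fst q" "snd q"] p[of q] that assms(2) by auto
    then show "(x, y) \<in> Q" using q by simp
  next
    assume "(x, y) \<in> Q"
    then show "\<exists>p \<in> mdom M. mem p c \<and> is_pair p x y"
      using p[of "(x, y)"] c(2) by (intro bexI[of _ "p (x, y)"]) simp_all
  qed
  then show ?thesis using c(1) by blast
qed

text \<open>A relation and not a function: identity of \<open>S12\<close> may be translated by an
  equivalence, so a number can be represented by many elements.\<close>

definition num :: "nat \<Rightarrow> nat \<Rightarrow> bool" where
  "num n x \<longleftrightarrow> holds M (\<lambda>_. x) (num_fm N n)"

definition num_eq :: "nat \<Rightarrow> nat \<Rightarrow> bool" where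
  "num_eq x y \<longleftrightarrow> holds M (case_nat x (\<lambda>_. y)) (tr N (Eq (Var 0) (Var 1)))"

lemma interp_ok: "interp_ok N S12_lang L"
  using interp by (simp add: relative_interpretation_def)

lemma num_eq_fm_syntax:
  "fvb (tr N (Eq (Var 0) (Var 1))) \<le> 2" "in_lang L (tr N (Eq (Var 0) (Var 1)))"
  using tr_Eq_syntax[OF interp_ok, of "Var 0" "Var 1" 2] by simp_all

lemma holds_num_fm [simp]: "holds M e (num_fm N n) \<longleftrightarrow> num n (e 0)"
  unfolding num_def by (rule holds_cong[OF num_fm_syntax(1)[OF interp_ok]]) simp

lemma holds_num_eq_fm:
  "holds M e (tr N (Eq (Var 0) (Var 1))) \<longleftrightarrow> num_eq (e 0) (e 1)"
  unfolding num_eq_def by (rule holds_cong[OF num_eq_fm_syntax(1)]) (auto simp: less_2_cases_iff)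

lemma holds_idom: "holds M e (idom N) \<longleftrightarrow> holds M (\<lambda>_. e 0) (idom N)"
proof (rule holds_cong)
  show "fvb (idom N) \<le> 1" using interp_ok by (simp add: interp_ok_def)
qed simp

lemma holds_tr_theorem:
  "sentence S12_lang \<phi> \<Longrightarrow> S12 \<turnstile> \<phi> \<Longrightarrow> range e \<subseteq> mdom M \<Longrightarrow> holds M e (tr N \<phi>)"
  using interp holds_theorem by (simp add: relative_interpretation_def)

lemma holds_tr_Var:
  "holds M (case_nat a e) (tr_tm N (Var i)) \<longleftrightarrow> holds M (\<lambda>_. a) (idom N) \<and> a = e i"
  using holds_idom[of "case_nat a e"] by simp

lemma holds_tr_Eq_bnum: "holds M e (tr N (Eq (Var i) (bnum n))) \<longleftrightarrow> num n (e i)"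
proof -
  have "holds M (case_nat b e) (tr_tm N (bnum n)) = holds M (case_nat b e') (tr_tm N (bnum n))" for b e e'
    using tr_tm_syntax[OF interp_ok in_lang_bnum fvb_bnum, of n 0]
    by (intro holds_cong[of _ 1]) auto
  moreover have "holds M (case_nat a (case_nat b e)) (ieq N) = holds M (case_nat a (case_nat b e')) (ieq N)"
    for a b e e'
    by (rule holds_cong[of _ 2]) (use interp_ok in \<open>auto simp: interp_ok_def less_2_cases_iff\<close>)
  ultimately have "holds M e (tr N (Eq (Var i) (bnum n))) \<longleftrightarrow>
      holds M (\<lambda>_. e i) (tr N (Eq (Var 0) (bnum n)))"
    unfolding holds_tr_Eq holds_tr_Var by metis
  then show ?thesis by (simp add: num_def num_fm_def)
qed

lemma num_idom: "num n x \<Longrightarrow> holds M (\<lambda>_. x) (idom N)"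
  unfolding num_def num_fm_def holds_tr_Eq holds_tr_Var by auto

lemma num_eq_idom:
  assumes "num_eq x y"
  shows "holds M (\<lambda>_. x) (idom N)"
  using assms unfolding num_eq_def holds_tr_Eq holds_tr_Var by auto

lemma num_ex: "\<exists>x \<in> mdom M. num n x"
proof -
  obtain e :: "nat \<Rightarrow> nat" where "range e \<subseteq> mdom M"
    using total_struct_env[OF total] by blast
  from holds_tr_theorem[OF sentence_bnum(1) S12_proves_bnum_ex this, of n]
  show ?thesis by (auto simp: holds_tr_Eq_bnum simp del: tr.simps(2))
qed

text \<open>Together with \<open>gn_inj\<close> this keeps the codes of different formulas apart in
  the model, so what is put into a coded set for one formula cannot disturb the axiom of
  another.\<close>

lemma num_unique:
  assumes "num n x" "num m x" "x \<in> mdom M"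
  shows "n = m"
proof (rule ccontr)
  assume "n \<noteq> m"
  have "range (\<lambda>_. x) \<subseteq> mdom M" using assms by auto
  from holds_tr_theorem[OF sentence_bnum(2) S12_proves_bnum_distinct[OF \<open>n \<noteq> m\<close>] this]
    holds_idom[of "case_nat x (\<lambda>_. x)"] assms num_idom[OF assms(1)]
  show False by (auto simp: holds_tr_Eq_bnum simp del: tr.simps(2))
qed

lemma num_iff_num_eq:
  assumes "num n y" "x \<in> mdom M" "y \<in> mdom M"
  shows "num n x \<longleftrightarrow> num_eq x y"
proof -
  have *: "num n x \<longleftrightarrow> num_eq x y" if x: "holds M (\<lambda>_. x) (idom N)"
  proof -
    let ?\<phi> = "Imp (Eq (Var 1) (bnum n)) (Iff (Eq (Var 0) (bnum n)) (Eq (Var 0) (Var 1)))"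
    let ?e = "case_nat y (\<lambda>_. x)"
    have "range (\<lambda>_. x) \<subseteq> mdom M" using assms by auto
    from holds_tr_theorem[OF sentence_bnum(3) S12_proves_bnum_eq this, of n]
    have "holds M (\<lambda>_. x) (All (Imp (idom N) (All (Imp (idom N) (tr N ?\<phi>)))))"
      unfolding tr.simps(5) .
    moreover have "holds M ?e (idom N)" "holds M (case_nat x ?e) (idom N)"
      using x num_idom[OF assms(1)] by (subst holds_idom; simp)+
    ultimately have "holds M (case_nat x ?e) (tr N ?\<phi>)"
      using assms(2,3) unfolding holds.simps(4,5) by blast
    then show ?thesis
      using assms(1)
      unfolding tr.simps(1,4) holds.simps(1,4) holds_tr_Eq_bnum holds_num_eq_fm by (auto simp del: tr.simps)
  qed
  \<comment> \<open>Outside the domain of the interpretation both sides are false, because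
    translated equations hold only of elements of the domain.\<close>
  show ?thesis using * num_idom num_eq_idom by blast
qed

section \<open>Undefinability of satisfaction\<close>

text \<open>The environment \<open>e\<close> lists infinitely many parameters, of which \<chi> reads
  finitely many. Induction on their number: a pair takes the place of the first two, and the formula
  unpacks it by quantifiers. Injectivity of pairs makes the unpacking unambiguous.\<close>

lemma merge_params:
  assumes "in_lang L \<chi>" "range e \<subseteq> mdom M"
  obtains \<chi>' b where "in_lang L \<chi>'" "fvb \<chi>' \<le> 3" "b \<in> mdom M"
    "\<And>x y. x \<in> mdom M \<Longrightarrow> y \<in> mdom M \<Longrightarrow>
       holds M (case_nat x (case_nat y e)) \<chi> \<longleftrightarrow> holds M (case_nat x (case_nat y (\<lambda>_. b))) \<chi>'"
proof -
  have "\<exists>\<chi>' b. in_lang L \<chi>' \<and> fvb \<chi>' \<le> 3 \<and> b \<in> mdom M \<and> (\<forall>x \<in> mdom M. \<forall>y \<in> mdom M.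
       holds M (case_nat x (case_nat y e)) \<chi> \<longleftrightarrow> holds M (case_nat x (case_nat y (\<lambda>_. b))) \<chi>')"
    if "fvb \<chi> \<le> 3 + n" for n
    using that assms
  proof (induction n arbitrary: \<chi> e)
    case 0
    have "holds M (case_nat x (case_nat y e)) \<chi> \<longleftrightarrow> holds M (case_nat x (case_nat y (\<lambda>_. e 0))) \<chi>" for x y
      by (rule holds_cong[of _ 3]) (use 0 in \<open>auto simp: numeral_3_eq_3 less_Suc_eq split: nat.split\<close>)
    then show ?case using 0 by (intro exI[of _ \<chi>] exI[of _ "e 0"]) auto
  next
    case (Suc n)
    \<comment> \<open>Under the two new quantifiers indices 0 and 1 are the second and first
      component, 2 and 3 are the arguments \<open>x\<close> and \<open>y\<close>, 4 is the pair, and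
      the other parameters follow from 5 on.\<close>
    let ?\<rho> = "\<lambda>i. Var (case i of 0 \<Rightarrow> 2 | Suc 0 \<Rightarrow> 3 | Suc (Suc 0) \<Rightarrow> 1 | Suc (Suc (Suc 0)) \<Rightarrow> 0
      | Suc (Suc (Suc (Suc j))) \<Rightarrow> 5 + j) :: nat tm"
    let ?\<chi> = "Ex (Ex (And (pair_at G 4 1 0) (subst ?\<rho> \<chi>)))"
    have e: "e i \<in> mdom M" for i using Suc.prems by auto
    obtain p where p: "p \<in> mdom M" "is_pair p (e 0) (e 1)"
      using is_pair_ex e by blast
    let ?e = "case_nat p (\<lambda>i. e (Suc (Suc i)))"
    have "fvb (subst ?\<rho> \<chi>) \<le> 5 + n"
      by (rule fvb_subst[OF Suc.prems(1)]) (auto simp: fvb_tm.simps split: nat.split)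
    moreover have "fvb (pair_at G 4 1 0) \<le> 5 + n"
      using fvb_pair_at[of G 4 1 0, OF fvb_Mem] by simp
    ultimately have "fvb ?\<chi> \<le> 3 + n" by auto
    moreover have "in_lang L ?\<chi>"
      using in_lang_pair_at[of L G, OF in_lang_Mem] in_lang_subst[OF Suc.prems(2) order_refl] by simp
    moreover have "range ?e \<subseteq> mdom M" using e p by (auto split: nat.split)
    ultimately obtain \<chi>' b where IH: "in_lang L \<chi>'" "fvb \<chi>' \<le> 3" "b \<in> mdom M"
      "\<forall>x \<in> mdom M. \<forall>y \<in> mdom M.
       holds M (case_nat x (case_nat y ?e)) ?\<chi> \<longleftrightarrow> holds M (case_nat x (case_nat y (\<lambda>_. b))) \<chi>'"
      using Suc.IH[of ?\<chi> ?e] by blast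
    have "holds M (case_nat x (case_nat y ?e)) ?\<chi> \<longleftrightarrow> holds M (case_nat x (case_nat y e)) \<chi>" for x y
    proof -
      have env: "(\<lambda>i. eval_tm M (case_nat v (case_nat u (case_nat x (case_nat y ?e)))) (?\<rho> i))
          = case_nat x (case_nat y (case_nat u (case_nat v (\<lambda>i. e (Suc (Suc i))))))" for u v
        by (auto simp: numeral_eq_Suc split: nat.split)
      have "holds M (case_nat x (case_nat y ?e)) ?\<chi> \<longleftrightarrow> (\<exists>u \<in> mdom M. \<exists>v \<in> mdom M. is_pair p u v \<and>
          holds M (case_nat x (case_nat y (case_nat u (case_nat v (\<lambda>i. e (Suc (Suc i))))))) \<chi>)"
        unfolding holds_connectives(1,4) holds_pair_at holds_subst env
        by (simp add: numeral_eq_Suc)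
      also have "\<dots> \<longleftrightarrow> holds M (case_nat x (case_nat y (case_nat (e 0) (case_nat (e 1) (\<lambda>i. e (Suc (Suc i))))))) \<chi>"
        using p(2) is_pair_inj[OF p(2)] e by metis
      also have "case_nat (e 0) (case_nat (e 1) (\<lambda>i. e (Suc (Suc i)))) = e"
        by (auto split: nat.split)
      finally show ?thesis .
    qed
    then show ?case using IH by blast
  qed
  from this[of "fvb \<chi>"] show thesis using that by auto
qed

text \<open>The liar formula says of a pair of (a number for) its own code and the parameter \<open>b\<close> that
  it does not satisfy the formula with that code.\<close>

lemma satisfaction_undefinable:
  assumes "in_lang L \<chi>" "range e \<subseteq> mdom M"
  shows "\<not> (\<forall>\<theta> p. in_lang L \<theta> \<and> fvb \<theta> \<le> 1 \<and> p \<in> mdom M \<longrightarrow>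
    ((\<exists>x \<in> mdom M. num (gn \<theta>) x \<and> holds M (case_nat x (case_nat p e)) \<chi>) \<longleftrightarrow> holds M (\<lambda>_. p) \<theta>))"
proof
  assume sat: "\<forall>\<theta> p. in_lang L \<theta> \<and> fvb \<theta> \<le> 1 \<and> p \<in> mdom M \<longrightarrow>
    ((\<exists>x \<in> mdom M. num (gn \<theta>) x \<and> holds M (case_nat x (case_nat p e)) \<chi>) \<longleftrightarrow> holds M (\<lambda>_. p) \<theta>)"
  obtain \<chi>' b where \<chi>': "in_lang L \<chi>'" "fvb \<chi>' \<le> 3" and b: "b \<in> mdom M" and
    eq: "\<And>x y. x \<in> mdom M \<Longrightarrow> y \<in> mdom M \<Longrightarrow>
       holds M (case_nat x (case_nat y e)) \<chi> \<longleftrightarrow> holds M (case_nat x (case_nat y (\<lambda>_. b))) \<chi>'"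
    using merge_params[OF assms] by metis
  define S where "S x p z \<longleftrightarrow> holds M (case_nat x (case_nat p (\<lambda>_. z))) \<chi>'" for x p z
  have S: "holds M e \<chi>' \<longleftrightarrow> S (e 0) (e 1) (e 2)" for e
    unfolding S_def by (rule holds_cong[OF \<chi>'(2)]) (auto simp: numeral_3_eq_3 less_Suc_eq numeral_2_eq_2)
  \<comment> \<open>In the innermost scope of the liar formula index 0 is the candidate code
    \<open>x\<close>, 1 the parameter \<open>z\<close>, 2 the representative \<open>y\<close>, and 3
    the pair \<open>p\<close>. \<open>E\<close> compares \<open>x\<close> with \<open>y\<close> in
    the sense of \<open>N\<close>; \<open>F\<close> applies the satisfaction formula to
    \<open>x\<close>, \<open>p\<close> and \<open>z\<close>.\<close>
  define E where "E = subst (\<lambda>i. if i = 0 then Var 0 else Var 2) (tr N (Eq (Var 0) (Var 1)))"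
  define F where "F = subst (\<lambda>i. if i = 0 then Var 0 else if i = 1 then Var 3 else Var 1) \<chi>'"
  let ?\<theta> = "Ex (Ex (And (pair_at G 2 1 0) (Neg (Ex (And E F)))))"
  have "fvb E \<le> 4"
    unfolding E_def by (rule fvb_subst[OF num_eq_fm_syntax(1)]) (auto simp: fvb_tm.simps)
  moreover have "fvb F \<le> 4"
    unfolding F_def by (rule fvb_subst[OF \<chi>'(2)]) (auto simp: fvb_tm.simps)
  moreover have "fvb (pair_at G 2 1 0) \<le> 3"
    using fvb_pair_at[of G 2 1 0, OF fvb_Mem] by simp
  ultimately have "fvb ?\<theta> \<le> 1" by auto
  moreover have "in_lang L E" "in_lang L F"
    unfolding E_def F_def using in_lang_subst[OF num_eq_fm_syntax(2) order_refl] in_lang_subst[OF \<chi>'(1) order_refl] by simp_all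
  then have "in_lang L ?\<theta>" by (simp add: in_lang_pair_at in_lang_Mem)
  ultimately have sat': "(\<exists>x \<in> mdom M. num (gn ?\<theta>) x \<and> S x p b) \<longleftrightarrow> holds M (\<lambda>_. p) ?\<theta>"
    if "p \<in> mdom M" for p
    using sat that eq by (metis (no_types, lifting) S_def)
  have E: "holds M e E \<longleftrightarrow> num_eq (e 0) (e 2)" and F: "holds M e F \<longleftrightarrow> S (e 0) (e 3) (e 1)" for e
    unfolding E_def F_def holds_subst holds_num_eq_fm S by simp_all
  have \<theta>: "holds M (\<lambda>_. p) ?\<theta> \<longleftrightarrow> (\<exists>y \<in> mdom M. \<exists>z \<in> mdom M. is_pair p y z \<and>
      \<not> (\<exists>x \<in> mdom M. num_eq x y \<and> S x p z))" for p
    by (simp add: holds_pair_at E F)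
  \<comment> \<open>Here the diagonalisation takes place: the liar formula is already fixed, and its
    own code now becomes part of the argument \<open>p\<close>.\<close>
  obtain y where y: "y \<in> mdom M" "num (gn ?\<theta>) y" using num_ex by blast
  obtain p where p: "p \<in> mdom M" "is_pair p y b" using is_pair_ex y b by blast
  have "holds M (\<lambda>_. p) ?\<theta> \<longleftrightarrow> \<not> (\<exists>x \<in> mdom M. num_eq x y \<and> S x p b)"
    unfolding \<theta> using p y b is_pair_inj[OF p(2)] by blast
  also have "\<dots> \<longleftrightarrow> \<not> (\<exists>x \<in> mdom M. num (gn ?\<theta>) x \<and> S x p b)"
    using num_iff_num_eq[OF y(2)] y(1) by blast
  also have "\<dots> \<longleftrightarrow> \<not> holds M (\<lambda>_. p) ?\<theta>" using sat'[OF p(1)] by blast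
  finally show False by blast
qed

end

section \<open>Injectivity of the Goedel numbering\<close>

text \<open>Each binary digit is preceded by \<open>True\<close>, and a single \<open>False\<close>
  ends the number, so no code is a proper prefix of another. The arbitrary suffixes allow a
  concatenation of codes to be peeled off from the left.\<close>

lemma nat_bits_append_eq: "nat_bits m @ xs = nat_bits n @ ys \<Longrightarrow> m = n \<and> xs = ys"
proof (induction m arbitrary: n rule: nat_bits.induct)
  case (1 m)
  show ?case
  proof (cases "m = 0 \<or> n = 0")
    case True
    then show ?thesis
      using "1.prems" nat_bits.simps[of m] nat_bits.simps[of n] by (auto split: if_splits)
  next
    case False
    then have "odd m = odd n" "nat_bits (m div 2) @ xs = nat_bits (n div 2) @ ys"
      using "1.prems" nat_bits.simps[of m] nat_bits.simps[of n] by auto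
    moreover from this have "m div 2 = n div 2" "xs = ys" using "1.IH" False by blast+
    ultimately show ?thesis by (metis bit_eq_rec)
  qed
qed

lemma concat_bits_append_eq:
  assumes "\<And>t u xs ys. t \<in> set ts \<Longrightarrow> f t @ xs = f u @ ys \<Longrightarrow> t = u \<and> xs = ys"
    and "length ts = length us" "concat (map f ts) @ xs = concat (map f us) @ ys"
  shows "ts = us \<and> xs = ys"
  using assms(2,1,3)
proof (induction ts us rule: list_induct2)
  case (Cons t ts u us)
  from Cons.prems have "f t @ concat (map f ts) @ xs = f u @ concat (map f us) @ ys" by simp
  then have eq: "t = u \<and> concat (map f ts) @ xs = concat (map f us) @ ys"
    by (rule Cons.prems(1)[rotated]) simp
  have "ts = us \<and> xs = ys"
    by (rule Cons.IH) (use Cons.prems(1) eq in auto)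
  with eq show ?case by simp
qed simp

lemma tm_bits_append_eq: "tm_bits t @ xs = tm_bits u @ ys \<Longrightarrow> t = u \<and> xs = ys"
proof (induction t arbitrary: u xs ys)
  case (Var i)
  then show ?case by (cases u) (auto dest: nat_bits_append_eq)
next
  case (Fun f ts)
  then obtain g us where u: "u = Fun g us" by (cases u) auto
  with Fun.prems have "nat_bits f @ nat_bits (length ts) @ concat (map tm_bits ts) @ xs =
      nat_bits g @ nat_bits (length us) @ concat (map tm_bits us) @ ys" by simp
  then have "f = g" "length ts = length us"
    "concat (map tm_bits ts) @ xs = concat (map tm_bits us) @ ys"
    by (blast dest: nat_bits_append_eq)+
  with concat_bits_append_eq[of ts tm_bits us xs ys] Fun.IH u show ?case by blast
qed

lemma fm_bits_append_eq: "fm_bits \<phi> @ xs = fm_bits \<psi> @ ys \<Longrightarrow> \<phi> = \<psi> \<and> xs = ys"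
proof (induction \<phi> arbitrary: \<psi> xs ys)
  case Falsum
  then show ?case by (cases \<psi>) auto
next
  case (Eq s t)
  then obtain s' t' where \<psi>: "\<psi> = Eq s' t'" by (cases \<psi>) auto
  with Eq have "tm_bits s @ tm_bits t @ xs = tm_bits s' @ tm_bits t' @ ys" by simp
  then show ?case using \<psi> tm_bits_append_eq by blast
next
  case (Rel r ts)
  then obtain q us where \<psi>: "\<psi> = Rel q us" by (cases \<psi>) auto
  with Rel have "nat_bits r @ nat_bits (length ts) @ concat (map tm_bits ts) @ xs =
      nat_bits q @ nat_bits (length us) @ concat (map tm_bits us) @ ys" by simp
  then have "r = q" "length ts = length us"
    "concat (map tm_bits ts) @ xs = concat (map tm_bits us) @ ys"
    by (blast dest: nat_bits_append_eq)+
  with concat_bits_append_eq[of ts tm_bits us xs ys] tm_bits_append_eq \<psi> show ?case by blast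
next
  case (Imp \<phi>1 \<phi>2)
  from Imp.prems obtain \<psi>1 \<psi>2 where \<psi>: "\<psi> = Imp \<psi>1 \<psi>2" by (cases \<psi>) auto
  with Imp.prems have "fm_bits \<phi>1 @ fm_bits \<phi>2 @ xs = fm_bits \<psi>1 @ fm_bits \<psi>2 @ ys" by simp
  note Imp.IH(1)[OF this]
  moreover from this have "fm_bits \<phi>2 @ xs = fm_bits \<psi>2 @ ys" by simp
  note Imp.IH(2)[OF this]
  ultimately show ?case using \<psi> by simp
next
  case (All \<phi>)
  from All.prems obtain \<psi>' where \<psi>: "\<psi> = All \<psi>'" by (cases \<psi>) auto
  with All.prems have "fm_bits \<phi> @ xs = fm_bits \<psi>' @ ys" by simp
  then show ?case using \<psi> All.IH by blast
qed

text \<open>The last bit is the parity of the value, hence the induction from the right. The start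
  value 1 keeps every intermediate value positive, so a string and a proper extension of it cannot
  collide through leading \<open>False\<close> bits.\<close>

lemma foldl_bits_inj:
  fixes f :: "nat \<Rightarrow> bool \<Rightarrow> nat"
  defines "f \<equiv> \<lambda>n b. 2 * n + of_bool b"
  shows "foldl f 1 bs = foldl f 1 cs \<Longrightarrow> bs = cs"
proof (induction bs arbitrary: cs rule: rev_induct)
  have pos: "foldl f 1 bs \<ge> 1" for bs
    by (induction bs rule: rev_induct) (auto simp: f_def)
  {
    case Nil
    then show ?case
    proof (cases cs rule: rev_cases)
      case (snoc ds d)
      then show ?thesis using Nil pos[of ds] by (simp add: f_def)
    qed simp
  next
    case (snoc b bs)
    show ?case
    proof (cases cs rule: rev_cases)
      case Nil
      then show ?thesis using snoc.prems pos[of bs] by (simp add: f_def)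
    next
      case (snoc ds d)
      then have "2 * foldl f 1 bs + of_bool b = 2 * foldl f 1 ds + of_bool d"
        using snoc.prems by (simp add: f_def)
      then have "foldl f 1 bs = foldl f 1 ds \<and> b = d"
        by (cases b; cases d) (simp_all, presburger+)
      then show ?thesis using snoc snoc.IH by blast
    qed
  }
qed

lemma gn_inj: "gn \<phi> = gn \<psi> \<Longrightarrow> \<phi> = \<psi>"
  unfolding gn_def using foldl_bits_inj fm_bits_append_eq[of \<phi> "[]" \<psi> "[]"] by simp

section \<open>Structures whose fresh predicates are defined with a parameter\<close>

text \<open>The arguments fill the first indices of \<delta> and all later indices carry
  \<open>c\<close>. The arity is thus read off the argument list, and one construction serves the
  unary \<open>T\<close> and the binary \<open>D\<close>.\<close>

definition param_struct ::
  "(nat, nat) fm \<Rightarrow> 'm \<Rightarrow> ('m, nat, nat) struct \<Rightarrow> ('m, nat, nat xrel) struct" where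
  "param_struct \<delta> c M = \<lparr>mdom = mdom M, mfn = mfn M,
     mrel = \<lambda>R xs. (case R of Base r \<Rightarrow> mrel M r xs
       | _ \<Rightarrow> holds M (\<lambda>i. if i < length xs then xs ! i else c) \<delta>)\<rparr>"

text \<open>In \<open>expand\<close>, a constant for an object outside the domain denotes that
  object, which violates totality. Derivations may pass through such constants, so here they denote
  \<open>d\<close>; on the language with constants for the domain the two expansions agree.\<close>

definition expand_total :: "('m, 'f, 'r) struct \<Rightarrow> 'm \<Rightarrow> ('m, 'f + 'm, 'r) struct" where
  "expand_total M d = \<lparr>mdom = mdom M,
     mfn = case_sum (mfn M) (\<lambda>a _. if a \<in> mdom M then a else d), mrel = mrel M\<rparr>"

lemma param_struct_simps [simp]:
  "mdom (param_struct \<delta> c M) = mdom M" "mfn (param_struct \<delta> c M) = mfn M"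
  "mrel (param_struct \<delta> c M) (Base r) = mrel M r"
  "(\<And>r. R \<noteq> Base r) \<Longrightarrow> mrel (param_struct \<delta> c M) R xs \<longleftrightarrow>
     holds M (\<lambda>i. if i < length xs then xs ! i else c) \<delta>"
  by (auto simp: param_struct_def fun_eq_iff split: xrel.split)

lemma expand_total_simps [simp]:
  "mdom (expand_total M d) = mdom M" "mrel (expand_total M d) = mrel M"
  "mfn (expand_total M d) (Inl f) = mfn M f"
  "mfn (expand_total M d) (Inr a) xs = (if a \<in> mdom M then a else d)"
  by (simp_all add: expand_total_def fun_eq_iff)

lemma total_param_struct: "total_struct M \<Longrightarrow> total_struct (param_struct \<delta> c M)"
  by (simp add: total_struct_def)

lemma total_expand_total:
  assumes "total_struct M" "d \<in> mdom M"
  shows "total_struct (expand_total M d)"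
proof -
  have "mfn (expand_total M d) f xs \<in> mdom M" if "set xs \<subseteq> mdom M" for f xs
    using assms that by (cases f) (auto simp: total_struct_def)
  then show ?thesis using assms by (auto simp: total_struct_def)
qed

lemma eval_expand_total:
  "in_lang_tm (with_consts (mdom M) L) t \<Longrightarrow> eval_tm (expand_total M d) e t = eval_tm (expand M) e t"
proof (induction t)
  case (Fun f ts)
  then have "map (eval_tm (expand_total M d) e) ts = map (eval_tm (expand M) e) ts" by simp
  moreover have "mfn (expand_total M d) f xs = mfn (expand M) f xs" for xs
    using Fun.prems by (cases f) (auto simp: with_consts_def expand_def)
  ultimately show ?case by (simp only: eval_tm.simps)
qed simp

lemma holds_expand_total:
  "in_lang (with_consts (mdom M) L) \<phi> \<Longrightarrow> holds (expand_total M d) e \<phi> \<longleftrightarrow> holds (expand M) e \<phi>"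
proof (induction \<phi> arbitrary: e)
  case (Rel r ts)
  then have "map (eval_tm (expand_total M d) e) ts = map (eval_tm (expand M) e) ts"
    using eval_expand_total[of M L] by simp
  then show ?case by (simp only: holds.simps) (simp add: expand_def)
next
  case (Eq s t)
  then show ?case using eval_expand_total[of M L] by simp
next
  case (All \<phi>)
  then show ?case by (simp add: expand_def)
qed auto

lemma ElDiag_sound:
  assumes "ElDiag L M \<turnstile> \<phi>" "total_struct M" "d \<in> mdom M" "range e \<subseteq> mdom M"
  shows "holds (expand_total M d) e \<phi>"
proof (rule soundness[OF assms(1) total_expand_total[OF assms(2,3)]])
  show "holds (expand_total M d) e \<gamma>" if "\<gamma> \<in> ElDiag L M" for \<gamma>
    using that assms(4) holds_expand_total[of M L \<gamma>]
    by (auto simp: ElDiag_def sentence_def true_in_def expand_def)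
qed (use assms(4) in simp)

lemma eval_param_struct [simp]: "eval_tm (param_struct \<delta> c M) e t = eval_tm M e t"
  by (induction t) (auto intro!: arg_cong[where f = "mfn M _"])

lemma holds_emb [simp]: "holds (param_struct \<delta> c M) e (emb \<phi>) \<longleftrightarrow> holds M e \<phi>"
  by (induction \<phi> arbitrary: e) (simp_all add: comp_def tm.map_id)

text \<open>Elements of the domain are natural numbers; the constant for \<open>a\<close> becomes the variable
  \<open>B + a\<close>, where \<open>B\<close> bounds the indices in use.\<close>

primrec elim_tm :: "nat \<Rightarrow> (nat + nat) tm \<Rightarrow> nat tm" where
  "elim_tm B (Var i) = Var i"
| "elim_tm B (Fun f ts) = (case f of Inl g \<Rightarrow> Fun g (map (elim_tm B) ts) | Inr a \<Rightarrow> Var (B + a))"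

text \<open>Atoms with a fresh predicate are replaced by \<delta>, whose parameter \<open>c\<close>
  is treated like the constant for \<open>c\<close>. Under a quantifier \<open>B\<close> grows by
  one, so the variables standing for constants are never captured.\<close>

primrec elim :: "(nat, nat) fm \<Rightarrow> nat \<Rightarrow> nat \<Rightarrow> (nat + nat, nat xrel) fm \<Rightarrow> (nat, nat) fm" where
  "elim \<delta> c B Falsum = Falsum"
| "elim \<delta> c B (Eq s t) = Eq (elim_tm B s) (elim_tm B t)"
| "elim \<delta> c B (Rel R ts) = (case R of Base r \<Rightarrow> Rel r (map (elim_tm B) ts)
     | _ \<Rightarrow> subst (\<lambda>i. if i < length ts then elim_tm B (ts ! i) else Var (B + c)) \<delta>)"
| "elim \<delta> c B (Imp \<phi> \<psi>) = Imp (elim \<delta> c B \<phi>) (elim \<delta> c B \<psi>)"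
| "elim \<delta> c B (All \<phi>) = All (elim \<delta> c (Suc B) \<phi>)"

lemma eval_elim_tm:
  assumes "\<And>i. i < B \<Longrightarrow> e' i = e i" "\<And>a. e' (B + a) = (if a \<in> mdom M then a else d)"
  shows "fvb_tm t \<le> B \<Longrightarrow>
    eval_tm M e' (elim_tm B t) = eval_tm (expand_total (param_struct \<delta> c M) d) e t"
proof (induction t)
  case (Var i)
  then show ?case using assms(1) by (simp add: fvb_tm.simps)
next
  case (Fun f ts)
  show ?case
  proof (cases f)
    case (Inl g)
    then have "map (\<lambda>t. eval_tm M e' (elim_tm B t)) ts =
        map (eval_tm (expand_total (param_struct \<delta> c M) d) e) ts" using Fun by simp
    then show ?thesis using Inl by (simp add: comp_def del: map_eq_conv)
  next
    case (Inr a)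
    then show ?thesis using assms(2) by simp
  qed
qed

text \<open>The environment supplies every element of the model as a parameter at once: position
  \<open>B + a\<close> holds \<open>a\<close>, or the default \<open>d\<close> when \<open>a\<close>
  is no element. A definition that uses constants of the model thereby becomes an ordinary
  formula.\<close>

lemma holds_elim:
  assumes "c \<in> mdom M"
  shows "fvb \<phi> \<le> B \<Longrightarrow> (\<And>i. i < B \<Longrightarrow> e' i = e i) \<Longrightarrow>
    (\<And>a. e' (B + a) = (if a \<in> mdom M then a else d)) \<Longrightarrow>
    holds M e' (elim \<delta> c B \<phi>) \<longleftrightarrow> holds (expand_total (param_struct \<delta> c M) d) e \<phi>"
proof (induction \<phi> arbitrary: B e e')
  case (Eq s t)
  then show ?case using eval_elim_tm[of B e' e M d] by simp
next
  case (Rel R ts)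
  let ?M = "expand_total (param_struct \<delta> c M) d"
  have "eval_tm M e' (elim_tm B t) = eval_tm ?M e t" if "t \<in> set ts" for t
    by (rule eval_elim_tm) (use Rel that in auto)
  then have eq: "map (\<lambda>t. eval_tm M e' (elim_tm B t)) ts = map (eval_tm ?M e) ts" by simp
  have fresh: "holds M e' (subst (\<lambda>i. if i < length ts then elim_tm B (ts ! i) else Var (B + c)) \<delta>) \<longleftrightarrow>
      holds M (\<lambda>i. if i < length (map (eval_tm ?M e) ts) then map (eval_tm ?M e) ts ! i else c) \<delta>"
    unfolding holds_subst eq[symmetric]
    using Rel.prems(3)[of c] assms by (auto intro!: arg_cong[where f = "\<lambda>e. holds M e \<delta>"])
  show ?case
  proof (cases R)
    case (Base r)
    then show ?thesis using eq by (simp add: comp_def del: map_eq_conv)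
  qed (use fresh in simp_all)
next
  case (Imp \<phi> \<psi>)
  have "holds M e' (elim \<delta> c B \<phi>) \<longleftrightarrow> holds (expand_total (param_struct \<delta> c M) d) e \<phi>"
    by (rule Imp.IH(1)) (use Imp.prems in simp_all)
  moreover have "holds M e' (elim \<delta> c B \<psi>) \<longleftrightarrow> holds (expand_total (param_struct \<delta> c M) d) e \<psi>"
    by (rule Imp.IH(2)) (use Imp.prems in simp_all)
  ultimately show ?case by simp
next
  case (All \<phi>)
  have "holds M (case_nat x e') (elim \<delta> c (Suc B) \<phi>) \<longleftrightarrow>
      holds (expand_total (param_struct \<delta> c M) d) (case_nat x e) \<phi>" for x
    by (rule All.IH) (use All.prems in \<open>auto split: nat.split\<close>)
  then show ?case by simp
qed simp

lemma in_lang_elim_tm: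
  "in_lang_tm (with_consts A L') t \<Longrightarrow> funs L' = funs L \<Longrightarrow> in_lang_tm L (elim_tm B t)"
  by (induction t) (auto simp: with_consts_def)

lemma in_lang_elim:
  assumes "in_lang L \<delta>" "\<And>r k. R \<noteq> Base r"
  shows "in_lang (with_consts A (add_rel R k (base_lang L))) \<phi> \<Longrightarrow> in_lang L (elim \<delta> c B \<phi>)"
proof (induction \<phi> arbitrary: B)
  case (Rel Q ts)
  let ?L = "add_rel R k (base_lang L)"
  have ts: "in_lang_tm L (elim_tm B t)" if "t \<in> set ts" for t
    by (rule in_lang_elim_tm[of A ?L]) (use Rel that in \<open>auto simp: add_rel_def base_lang_def\<close>)
  then have "in_lang L (subst (\<lambda>i. if i < length ts then elim_tm B (ts ! i) else Var (B + c)) \<delta>)"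
    by (intro in_lang_subst[OF assms(1) order_refl]) simp
  moreover have "(r, length ts) \<in> rels L" if "Q = Base r" for r
    using Rel.prems that assms(2)[of r]
    by (auto simp: with_consts_def add_rel_def base_lang_def)
  ultimately show ?case using ts by (auto split: xrel.split)
next
  case (Eq s t)
  then show ?case
    using in_lang_elim_tm[of A "add_rel R k (base_lang L)" _ L B] by (simp add: add_rel_def base_lang_def)
qed auto

lemma eval_map_Inl:
  "eval_tm (expand_total (param_struct \<delta> c M) d) e (map_tm Inl t) = eval_tm M e t"
  by (induction t) (auto intro!: arg_cong[where f = "mfn M _"])

lemma direct_tr_base:
  assumes "\<forall>(r, k) \<in> rels (base_lang L). H r k = Rel r (map Var [0..<k])"
  shows "in_lang L \<phi> \<Longrightarrow>
    holds (expand_total (param_struct \<delta> c M) d) e (direct_tr H (map_fm Inl id (emb \<phi>))) \<longleftrightarrow> holds M e \<phi>"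
proof (induction \<phi> arbitrary: e)
  case (Rel r ts)
  have "(Base r, length ts) \<in> rels (base_lang L)"
    using Rel by (force simp: base_lang_def)
  then have "H (Base r) (length ts) = Rel (Base r) (map Var [0..<length ts])" using assms by auto
  moreover have "map (\<lambda>i. eval_tm (expand_total (param_struct \<delta> c M) d) e (map (map_tm Inl) ts ! i))
      [0..<length ts] = map (eval_tm M e) ts"
    by (rule nth_equalityI) (auto simp: eval_map_Inl)
  ultimately show ?case by (simp add: tm.map_ident comp_def del: map_eq_conv)
next
  case (Eq s t)
  show ?case by (simp add: eval_map_Inl tm.map_ident)
qed auto

context arith_model
begin

text \<open>A definition of \<open>S\<close> may use \<open>R\<close> and constants of the model.
  Eliminating both leaves an \<open>L\<close>-formula which, under a suitable environment, satisfies
  the \<open>USB\<close> equivalences in \<open>M\<close>, against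
  \<open>satisfaction_undefinable\<close>.\<close>

lemma param_struct_no_USB:
  fixes k :: nat
  assumes c: "c \<in> mdom M" and \<delta>: "in_lang L \<delta>" and R: "\<And>r. R \<noteq> Base r"
  defines "M' \<equiv> param_struct \<delta> c M" and "LR \<equiv> add_rel R k (base_lang L)"
  shows "\<not> syntactically_defines (with_consts (mdom M') (base_lang L))
          (with_consts (mdom M') LR) (ElDiag LR M')
          (with_consts (mdom M') (USB_lang L)) (map_fm Inl id ` USB L U N)"
proof
  assume "syntactically_defines (with_consts (mdom M') (base_lang L))
          (with_consts (mdom M') LR) (ElDiag LR M')
          (with_consts (mdom M') (USB_lang L)) (map_fm Inl id ` USB L U N)"
  then obtain H where
    H: "direct_interpretation H (with_consts (mdom M') (USB_lang L)) (map_fm Inl id ` USB L U N)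
      (with_consts (mdom M') LR) (ElDiag LR M')"
    and H_base: "\<forall>(r, k) \<in> rels (base_lang L). H r k = Rel r (map Var [0..<k])"
    by (auto simp: syntactically_defines_def with_consts_def)
  let ?\<phi> = "H SatP 2"
  have \<phi>: "in_lang (with_consts (mdom M') LR) ?\<phi>" "fvb ?\<phi> \<le> 2"
    using H by (auto simp: direct_interpretation_def with_consts_def USB_lang_def add_rel_def)
  let ?M = "expand_total M' c"
  have D: "mdom ?M = mdom M" by (simp add: M'_def)
  let ?\<chi> = "elim \<delta> c 2 ?\<phi>"
  \<comment> \<open>Each element names itself as a parameter; positions that are not elements get
    \<open>c\<close>, so that the environment stays in the domain. The offset 2 leaves indices 0 and
    1 for the arguments of \<open>S\<close>.\<close>
  let ?e = "\<lambda>a. if a \<in> mdom M then a else c"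
  have \<chi>: "holds M (case_nat (e 0) (case_nat (e 1) ?e)) ?\<chi> \<longleftrightarrow> holds ?M e ?\<phi>" for e
    unfolding M'_def
    by (rule holds_elim[OF c \<phi>(2)]) (auto simp: numeral_2_eq_2 less_Suc_eq)
  have SatP: "holds ?M e (direct_tr H (map_fm Inl id (Rel SatP [Var 0, Var 1]))) \<longleftrightarrow>
      holds M (case_nat (e 0) (case_nat (e 1) ?e)) ?\<chi>" for e
  proof -
    have "direct_tr H (map_fm Inl id (Rel SatP [Var 0, Var 1])) = subst (\<lambda>i. [Var 0, Var 1] ! i) ?\<phi>"
      by (simp add: numeral_2_eq_2)
    then show ?thesis using \<chi>[of "\<lambda>i. eval_tm ?M e ([Var 0, Var 1] ! i)"] by (simp add: holds_subst)
  qed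
  have "(\<exists>x \<in> mdom M. num (gn \<theta>) x \<and> holds M (case_nat x (case_nat p ?e)) ?\<chi>) \<longleftrightarrow> holds M (\<lambda>_. p) \<theta>"
    if \<theta>: "in_lang L \<theta>" "fvb \<theta> \<le> 1" and p: "p \<in> mdom M" for \<theta> p
  proof -
    let ?A = "All (Iff (Ex (And (emb (num_fm N (gn \<theta>))) (Rel SatP [Var 0, Var 1]))) (emb \<theta>))"
    have "?A \<in> USB L U N" using \<theta> by (auto simp: USB_def)
    then have "ElDiag LR M' \<turnstile> direct_tr H (map_fm Inl id ?A)"
      using H by (auto simp: direct_interpretation_def)
    then have "holds ?M (\<lambda>_. p) (direct_tr H (map_fm Inl id ?A))"
      by (rule ElDiag_sound) (use c p total in \<open>auto simp: M'_def total_param_struct\<close>)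
    then have "holds ?M (case_nat p (\<lambda>_. p)) (Iff
        (Ex (And (direct_tr H (map_fm Inl id (emb (num_fm N (gn \<theta>)))))
                 (direct_tr H (map_fm Inl id (Rel SatP [Var 0, Var 1])))))
        (direct_tr H (map_fm Inl id (emb \<theta>))))"
      using p unfolding fm.map(1,4,5) direct_tr.simps(1,4,5) holds.simps(5) D by blast
    moreover have "case_nat p (\<lambda>_. p) = (\<lambda>_. p)" by (auto split: nat.split)
    ultimately show ?thesis
      unfolding holds_connectives(3) unfolding holds_connectives(4) holds_connectives(1) SatP D
      unfolding M'_def direct_tr_base[OF H_base \<theta>(1)] direct_tr_base[OF H_base num_fm_syntax(2)[OF interp_ok]]
      by simp
  qed
  then show False
    using satisfaction_undefinable[of ?\<chi> ?e] in_lang_elim[OF \<delta> R, of "mdom M'" k ?\<phi> c 2] \<phi> c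
    by (auto simp: LR_def)
qed

end

lemma holds_ExU:
  "holds M e (ExU \<phi>) \<longleftrightarrow> (\<exists>a \<in> mdom M. holds M (case_nat a e) \<phi> \<and>
     (\<forall>b \<in> mdom M. holds M (case_nat b e) \<phi> \<longrightarrow> b = a))"
proof -
  have env: "(\<lambda>i. eval_tm M (case_nat b (case_nat a e)) (case i of 0 \<Rightarrow> Var 0 | Suc j \<Rightarrow> Var (Suc (Suc j))))
      = case_nat b e" for a b
    by (auto split: nat.split)
  have "holds M (case_nat a e) (And \<phi> (All (Imp
     (subst (\<lambda>i. case i of 0 \<Rightarrow> Var 0 | Suc j \<Rightarrow> Var (Suc (Suc j))) \<phi>)
     (Eq (Var 0) (Var 1))))) \<longleftrightarrow> (holds M (case_nat a e) \<phi> \<and>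
       (\<forall>b \<in> mdom M. holds M (case_nat b e) \<phi> \<longrightarrow> b = a))" for a
    unfolding holds_connectives(1) holds.simps(5) holds.simps(4) holds_subst env by simp
  then show ?thesis unfolding ExU_def holds_connectives(4) by (rule bex_cong[OF refl])
qed
lemma fvb_ExU:
  assumes "fvb \<phi> \<le> 1"
  shows "fvb (ExU \<phi>) \<le> 1"
proof -
  have "fvb (subst (\<lambda>i. case i of 0 \<Rightarrow> Var 0 | Suc j \<Rightarrow> Var (Suc (Suc j))) \<phi>) \<le> 1"
    by (rule fvb_subst[OF assms]) (simp add: fvb_tm.simps)
  then show ?thesis using assms by (auto simp: ExU_def fvb_tm.simps)
qed

section \<open>Models with a code for the fresh predicate\<close>

text \<open>The axioms with \<open>D\<close> or \<open>T\<close> replaced by the set coded by the free index 0, which is index 2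
  or 1 under the binders.\<close>

definition DEF_ax where
  "DEF_ax N G \<phi> =
     All (Iff (Ex (And (num_fm N (gn \<phi>)) (rel_fm G))) (And (ExU \<phi>) \<phi>))"

definition TB_ax where
  "TB_ax N G \<phi> = Iff (Ex (And (num_fm N (gn \<phi>)) (mem_fm G 0 1))) \<phi>"

context arith_model
begin

lemma num_rep: obtains r where "\<And>n. r n \<in> mdom M" "\<And>n. num n (r n)"
  using num_ex by metis

lemma is_model_param_struct:
  assumes "\<And>\<phi> e. \<phi> \<in> W \<Longrightarrow> range e \<subseteq> mdom M \<Longrightarrow> holds (param_struct \<delta> c M) e \<phi>"
  shows "is_model L' (param_struct \<delta> c M) (emb ` U \<union> W)"
  using assms model total by (auto simp: is_model_def is_struct_def true_in_def total_struct_def)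

definition sole_witness :: "(nat, nat) fm \<Rightarrow> nat \<Rightarrow> bool" where
  "sole_witness \<phi> y \<longleftrightarrow> y \<in> mdom M \<and> holds M (\<lambda>_. y) \<phi> \<and>
     (\<forall>b \<in> mdom M. holds M (\<lambda>_. b) \<phi> \<longrightarrow> b = y)"

lemma holds_ExU_and:
  assumes "fvb \<phi> \<le> 1" "y \<in> mdom M"
  shows "holds M (case_nat y e) (ExU \<phi>) \<and> holds M (case_nat y e) \<phi> \<longleftrightarrow> sole_witness \<phi> y"
proof -
  have "holds M (case_nat a e) \<phi> \<longleftrightarrow> holds M (\<lambda>_. a) \<phi>" for a e
    by (rule holds_cong[OF assms(1)]) simp
  then show ?thesis using assms(2) by (auto simp: holds_ExU sole_witness_def)
qed

lemma holds_DEF_ax: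
  assumes "fvb \<phi> \<le> 1"
  shows "holds M (\<lambda>_. c) (DEF_ax N G \<phi>) \<longleftrightarrow> (\<forall>y \<in> mdom M.
    (\<exists>x \<in> mdom M. num (gn \<phi>) x \<and> (\<exists>p \<in> mdom M. mem p c \<and> is_pair p x y)) \<longleftrightarrow> sole_witness \<phi> y)"
  unfolding DEF_ax_def holds_connectives(3) holds.simps(5)
  unfolding holds_connectives(4) holds_connectives(1) holds_rel_fm
  using holds_ExU_and[OF assms] by (simp add: numeral_2_eq_2)

lemma DEF_ax_finite:
  assumes "finite F" "\<And>\<phi>. \<phi> \<in> F \<Longrightarrow> fvb \<phi> \<le> 1"
  shows "\<exists>c \<in> mdom M. \<forall>\<phi> \<in> F. holds M (\<lambda>_. c) (DEF_ax N G \<phi>)"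
proof -
  obtain r where r: "\<And>n. r n \<in> mdom M" "\<And>n. num n (r n)" by (rule num_rep) blast
  define Q where "Q = {(r (gn \<phi>), y) | \<phi> y. \<phi> \<in> F \<and> sole_witness \<phi> y}"
  have "Q \<subseteq> (\<lambda>\<phi>. (r (gn \<phi>), THE y. sole_witness \<phi> y)) ` F"
  proof
    fix q assume "q \<in> Q"
    then obtain \<phi> y where q: "q = (r (gn \<phi>), y)" "\<phi> \<in> F" "sole_witness \<phi> y"
      unfolding Q_def by blast
    then have "(THE y. sole_witness \<phi> y) = y"
      by (intro the_equality) (auto simp: sole_witness_def)
    with q show "q \<in> (\<lambda>\<phi>. (r (gn \<phi>), THE y. sole_witness \<phi> y)) ` F" by auto
  qed
  then have "finite Q" using assms(1) finite_surj by blast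
  moreover have "Q \<subseteq> mdom M \<times> mdom M" using r by (auto simp: Q_def sole_witness_def)
  ultimately obtain c where c: "c \<in> mdom M" "\<And>x y. x \<in> mdom M \<Longrightarrow> y \<in> mdom M \<Longrightarrow>
      (\<exists>p \<in> mdom M. mem p c \<and> is_pair p x y) \<longleftrightarrow> (x, y) \<in> Q"
    using finite_rel_ex[of Q] by blast
  have "(\<exists>x \<in> mdom M. num (gn \<phi>) x \<and> (x, y) \<in> Q) \<longleftrightarrow> sole_witness \<phi> y"
    if "\<phi> \<in> F" "y \<in> mdom M" for \<phi> y
  proof
    assume "\<exists>x \<in> mdom M. num (gn \<phi>) x \<and> (x, y) \<in> Q"
    then obtain \<psi> where "num (gn \<phi>) (r (gn \<psi>))" "sole_witness \<psi> y"
      unfolding Q_def by blast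
    then show "sole_witness \<phi> y" using num_unique r gn_inj by metis
  next
    assume "sole_witness \<phi> y"
    then show "\<exists>x \<in> mdom M. num (gn \<phi>) x \<and> (x, y) \<in> Q" using that r unfolding Q_def by blast
  qed
  then have "\<forall>\<phi> \<in> F. holds M (\<lambda>_. c) (DEF_ax N G \<phi>)"
    using c(2) assms(2) by (simp add: holds_DEF_ax)
  then show ?thesis using c(1) by blast
qed

lemma DEF_model:
  assumes "\<And>\<phi>. in_lang L \<phi> \<Longrightarrow> fvb \<phi> \<le> 1 \<Longrightarrow> holds M (\<lambda>_. c) (DEF_ax N G \<phi>)"
  shows "is_model (DEF_lang L) (param_struct (rel_fm G) c M) (DEF L U N)"
  unfolding DEF_def
proof (rule is_model_param_struct)
  let ?M = "param_struct (rel_fm G) c M"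
  fix \<Phi> and e :: "nat \<Rightarrow> nat"
  assume "\<Phi> \<in> {All (Iff (Ex (And (emb (num_fm N (gn \<phi>))) (Rel DefP [Var 0, Var 1])))
    (And (ExU (emb \<phi>)) (emb \<phi>))) |\<phi>. in_lang L \<phi> \<and> fvb \<phi> \<le> 1}"
  then obtain \<phi> where \<phi>: "in_lang L \<phi>" "fvb \<phi> \<le> 1" and
    \<Phi>: "\<Phi> = All (Iff (Ex (And (emb (num_fm N (gn \<phi>))) (Rel DefP [Var 0, Var 1])))
      (And (ExU (emb \<phi>)) (emb \<phi>)))" by blast
  have "holds ?M (case_nat y e) (ExU (emb \<phi>)) \<longleftrightarrow> holds M (case_nat y e) (ExU \<phi>)" for y
    by (simp add: holds_ExU)
  moreover have "holds ?M (case_nat x (case_nat y e)) (Rel DefP [Var 0, Var 1]) \<longleftrightarrow>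
      (\<exists>p \<in> mdom M. mem p c \<and> is_pair p x y)" for x y
    by (simp add: holds_rel_fm)
  ultimately show "holds ?M e \<Phi>"
    using assms[OF \<phi>] holds_ExU_and[OF \<phi>(2)] holds_DEF_ax[OF \<phi>(2)]
    unfolding \<Phi> holds_connectives(3) holds.simps(5)
    unfolding holds_connectives(4) holds_connectives(1)
    by (simp del: holds.simps)
qed

lemma holds_TB_ax:
  "holds M (\<lambda>_. c) (TB_ax N G \<phi>) \<longleftrightarrow>
     ((\<exists>x \<in> mdom M. num (gn \<phi>) x \<and> mem x c) \<longleftrightarrow> holds M (\<lambda>_. c) \<phi>)"
  unfolding TB_ax_def holds_connectives(3) unfolding holds_connectives(4) holds_connectives(1) by simp

lemma holds_sentence: "fvb \<phi> = 0 \<Longrightarrow> holds M e \<phi> \<longleftrightarrow> holds M e' \<phi>"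
  by (rule holds_cong[of _ 0]) simp_all

lemma TB_ax_finite:
  assumes "finite F" "\<And>\<phi>. \<phi> \<in> F \<Longrightarrow> fvb \<phi> = 0"
  shows "\<exists>c \<in> mdom M. \<forall>\<phi> \<in> F. holds M (\<lambda>_. c) (TB_ax N G \<phi>)"
proof -
  obtain r where r: "\<And>n. r n \<in> mdom M" "\<And>n. num n (r n)" by (rule num_rep) blast
  \<comment> \<open>\<open>r\<close> is reused as an arbitrary environment with values in the
    domain; the truth of a sentence does not depend on it.\<close>
  let ?T = "{\<phi> \<in> F. holds M r \<phi>}"
  obtain c where c: "c \<in> mdom M" "\<And>w. w \<in> mdom M \<Longrightarrow> mem w c \<longleftrightarrow> w \<in> (r \<circ> gn) ` ?T"
    using finite_set_ex[of "(r \<circ> gn) ` ?T"] assms(1) r by fastforce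
  have "(\<exists>x \<in> mdom M. num (gn \<phi>) x \<and> mem x c) \<longleftrightarrow> holds M (\<lambda>_. c) \<phi>" if "\<phi> \<in> F" for \<phi>
  proof -
    have "(\<exists>x \<in> mdom M. num (gn \<phi>) x \<and> mem x c) \<longleftrightarrow> (\<exists>\<psi> \<in> ?T. num (gn \<phi>) (r (gn \<psi>)))"
      using c(2) r(1) by auto
    also have "\<dots> \<longleftrightarrow> \<phi> \<in> ?T" using num_unique r gn_inj by metis
    also have "\<dots> \<longleftrightarrow> holds M (\<lambda>_. c) \<phi>" using that holds_sentence[OF assms(2)[OF that]] by blast
    finally show ?thesis .
  qed
  then show ?thesis using c(1) by (auto simp: holds_TB_ax)
qed

lemma TB_model:
  assumes "\<And>\<phi>. sentence L \<phi> \<Longrightarrow> holds M (\<lambda>_. c) (TB_ax N G \<phi>)"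
  shows "is_model (TB_lang L) (param_struct (mem_fm G 0 1) c M) (TB L U N)"
  unfolding TB_def
proof (rule is_model_param_struct)
  let ?M = "param_struct (mem_fm G 0 1) c M"
  fix \<Phi> and e :: "nat \<Rightarrow> nat"
  assume "\<Phi> \<in> {Iff (Ex (And (emb (num_fm N (gn \<phi>))) (Rel TrueP [Var 0]))) (emb \<phi>) |\<phi>. sentence L \<phi>}"
  then obtain \<phi> where \<phi>: "sentence L \<phi>" and
    \<Phi>: "\<Phi> = Iff (Ex (And (emb (num_fm N (gn \<phi>))) (Rel TrueP [Var 0]))) (emb \<phi>)" by blast
  have "holds ?M (case_nat x e) (Rel TrueP [Var 0]) \<longleftrightarrow> mem x c" for x by simp
  then show "holds ?M e \<Phi>"
    using assms[OF \<phi>] holds_sentence[of \<phi> e "\<lambda>_. c"] \<phi>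
    unfolding \<Phi> holds_connectives(3) holds_TB_ax
    unfolding holds_connectives(4) holds_connectives(1)
    by (simp del: holds.simps add: sentence_def)
qed

end

text \<open>Compactness with free index 0 in the role of the code: a finite part of the axioms is
  realised by some \<open>c\<close> in any model of \<open>U\<close>, so by soundness it is
  consistent. Model existence for the whole set then returns an environment, and its value at 0 is
  the required element.\<close>

lemma param_model_exists:
  assumes U: "is_theory L U" "consistent U"
    and seq: "direct_interpretation G AS_lang AS L U"
    and interp: "relative_interpretation N S12_lang S12 L U"
    and fvb: "\<And>i. i \<in> I \<Longrightarrow> fvb (ax i) \<le> 1"
    and fin: "\<And>M F. arith_model L U N G M \<Longrightarrow> finite F \<Longrightarrow> F \<subseteq> I \<Longrightarrow>
      \<exists>c \<in> mdom M. \<forall>i \<in> F. holds M (\<lambda>_. c) (ax i)"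
  obtains M c where "arith_model L U N G M" "c \<in> mdom M" "\<And>i. i \<in> I \<Longrightarrow> holds M (\<lambda>_. c) (ax i)"
proof -
  have U0: "fvb \<phi> = 0" if "\<phi> \<in> U" for \<phi>
    using U(1) that by (auto simp: is_theory_def sentence_def)
  have am: "arith_model L U N G M"
    if "total_struct M" "\<And>\<phi>. \<phi> \<in> U \<Longrightarrow> holds M e \<phi>" for M e
  proof
    show "holds M e' \<phi>" if "\<phi> \<in> U" for \<phi> e'
      using \<open>\<And>\<phi>. \<phi> \<in> U \<Longrightarrow> holds M e \<phi>\<close>[OF that] holds_cong[of \<phi> 0 e e' M] U0[OF that] by simp
  qed (use that seq interp in auto)
  have "consistent (U \<union> ax ` I)"
  proof (rule consistent_finite)
    fix \<Delta> assume \<Delta>: "\<Delta> \<subseteq> U \<union> ax ` I" "finite \<Delta>"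
    then obtain F where F: "F \<subseteq> I" "finite F" "\<Delta> - U = ax ` F"
      using finite_subset_image[of "\<Delta> - U" ax I] by blast
    obtain M :: "(nat, nat, nat) struct" and e
      where M: "total_struct M" "\<And>\<phi>. \<phi> \<in> U \<Longrightarrow> holds M e \<phi>"
      using model_existence[OF U(2), of 0] U0 by (metis order_refl)
    then interpret arith_model L U N G M by (rule am)
    obtain c where c: "c \<in> mdom M" "\<forall>i \<in> F. holds M (\<lambda>_. c) (ax i)"
      using fin[OF _ F(2,1)] arith_model_axioms by blast
    have "holds M (\<lambda>_. c) \<delta>" if "\<delta> \<in> \<Delta>" for \<delta>
    proof (cases "\<delta> \<in> U")
      case True
      then show ?thesis using model c(1) by auto
    next
      case False
      then have "\<delta> \<in> ax ` F" using that F(3) by blast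
      then show ?thesis using c(2) by blast
    qed
    then show "consistent \<Delta>"
      unfolding consistent_def using soundness[of \<Delta> Falsum M "\<lambda>_. c"] total c(1) by auto
  qed
  moreover have "fvb \<gamma> \<le> 1" if "\<gamma> \<in> U \<union> ax ` I" for \<gamma>
    using that U0 fvb by fastforce
  ultimately obtain M :: "(nat, nat, nat) struct" and e
    where M: "total_struct M" "range e \<subseteq> mdom M" "\<And>\<gamma>. \<gamma> \<in> U \<union> ax ` I \<Longrightarrow> holds M e \<gamma>"
    using model_existence by blast
  have "holds M (\<lambda>_. e 0) (ax i)" if "i \<in> I" for i
    using M(3)[of "ax i"] that holds_cong[OF fvb[OF that], of e "\<lambda>_. e 0" M] by auto
  then show thesis using that[of M "e 0"] am[of M e] M by blast
qed

theorem theorem27: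
  fixes L :: "(nat, nat) lang" and U :: "(nat, nat) fm set" and N :: arith_interp
  assumes "re_lang L"
    and "is_theory L U"
    and "re_set (gn ` U)"
    and "consistent U"
    and "sequential L U"
    and "relative_interpretation N S12_lang S12 L U"
  shows "\<not> semantically_defines TYPE(nat) (base_lang L)
             (DEF_lang L) (DEF L U N) (USB_lang L) (USB L U N)
       \<and> \<not> semantically_defines TYPE(nat) (base_lang L)
             (TB_lang L) (TB L U N) (USB_lang L) (USB L U N)"
proof
  obtain G where G: "direct_interpretation G AS_lang AS L U"
    using assms(5) by (auto simp: sequential_def)
  have Mem: "fvb (G Mem 2) \<le> 2" "in_lang L (G Mem 2)"
    using G by (auto simp: direct_interpretation_def AS_lang_def)
  have num: "fvb (num_fm N n) \<le> 1" for n
    using num_fm_syntax assms(6) by (auto simp: relative_interpretation_def)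
  note ex = param_model_exists[OF assms(2,4) G assms(6)]
  show "\<not> semantically_defines TYPE(nat) (base_lang L)
             (DEF_lang L) (DEF L U N) (USB_lang L) (USB L U N)"
  proof -
    have "fvb (DEF_ax N G \<phi>) \<le> 1" if "fvb \<phi> \<le> 1" for \<phi>
      using num[of "gn \<phi>"] fvb_rel_fm[of G, OF Mem(1)] fvb_ExU[OF that] that by (auto simp: DEF_ax_def)
    then obtain M c where M: "arith_model L U N G M" "c \<in> mdom M"
      "\<And>\<phi>. in_lang L \<phi> \<Longrightarrow> fvb \<phi> \<le> 1 \<Longrightarrow> holds M (\<lambda>_. c) (DEF_ax N G \<phi>)"
      using ex[of "{\<phi>. in_lang L \<phi> \<and> fvb \<phi> \<le> 1}" "DEF_ax N G"] arith_model.DEF_ax_finite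
      by (smt (verit) mem_Collect_eq subset_eq)
    interpret arith_model L U N G M by (rule M(1))
    show ?thesis
      using DEF_model[OF M(3)] param_struct_no_USB[of c "rel_fm G" DefP 2] M(2)
        in_lang_rel_fm[of L G, OF Mem(2)]
      by (auto simp: semantically_defines_def DEF_lang_def)
  qed
  show "\<not> semantically_defines TYPE(nat) (base_lang L)
             (TB_lang L) (TB L U N) (USB_lang L) (USB L U N)"
  proof -
    have "fvb (TB_ax N G \<phi>) \<le> 1" if "sentence L \<phi>" for \<phi>
      using num[of "gn \<phi>"] fvb_mem_fm[of G 0 1, OF Mem(1)] that by (auto simp: TB_ax_def sentence_def)
    then obtain M c where M: "arith_model L U N G M" "c \<in> mdom M"
      "\<And>\<phi>. sentence L \<phi> \<Longrightarrow> holds M (\<lambda>_. c) (TB_ax N G \<phi>)"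
      using ex[of "{\<phi>. sentence L \<phi>}" "TB_ax N G"] arith_model.TB_ax_finite
      by (smt (verit) mem_Collect_eq subset_eq sentence_def)
    interpret arith_model L U N G M by (rule M(1))
    show ?thesis
      using TB_model[OF M(3)] param_struct_no_USB[of c "mem_fm G 0 1" TrueP 1] M(2)
        in_lang_mem_fm[of L G 0 1, OF Mem(2)]
      by (auto simp: semantically_defines_def TB_lang_def)
  qed
qed

end
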